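(* Skew Schubert polynomials are in $\mathrm{VNP}$: for any choice of permutations $\sigma_N\le\pi_N$ in $S_N$ (Bruhat order) for each $N$, the polynomial family $\{Y_{\pi_N/\sigma_N}(x_1,\dots,x_{N-1})\}_{N\in\mathbb{N}}$ is in $\mathrm{VNP}$. In particular, Schubert polynomials $Y_{\sigma_N}:=Y_{\pi_0/\sigma_N}$, where $\pi_0=N\,N{-}1\cdots1$ is the maximal permutation of $S_N$, form families in $\mathrm{VNP}$.
   Context: Permutations $\sigma\in S_N$ are written $\sigma(1)\cdots\sigma(N)$; $|\sigma|$ is the number of inversions. For $s<t$, $\sigma\tau_{st}$ is $\sigma$ with the values in positions $s,t$ exchanged. Bruhat order: transitive closure of covers $\sigma\lessdot\pi$, meaning $\pi=\sigma\tau_{st}$ for some $s<t$ and $|\pi|=|\sigma|+1$. Labeled Bruhat order: for each cover $\sigma\lessdot\pi$ with $\pi=\sigma\tau_{st}$ and each $j$ with $s\le j<t$ there is an edge $\sigma\to\pi$ labeled $(j,b)$, $b=\sigma(s)=\pi(t)$. A chain of such edges is increasing if its labels increase lexicographically. For a chain $C$, $\mathbf{e}(C)=(e_1,\dots,e_{N-1})$, $e_i$ = number of labels with first coordinate $i$. For $\sigma\le\pi$, $Y_{\pi/\sigma}(\mathbf{x})=\sum_C\mathbf{x}^{\mathbf{d}}/\mathbf{x}^{\mathbf{e}(C)}$ over increasing chains $C$ from $\sigma$ to $\pi$, with $\mathbf{d}=(N-1,\dots,1)$. $\mathrm{VP}$: families of polynomials in $\mathrm{poly}(n)$ variables of $\mathrm{poly}(n)$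 degree computable by $\mathrm{poly}(n)$-size arithmetic circuits; $\mathrm{VNP}$: families $g_n(\mathbf{x})=\sum_{\mathbf{c}\in\{0,1\}^{m}}f_n(\mathbf{x},\mathbf{c})$ with $m=\mathrm{poly}(n)$ and $\{f_n\}\in\mathrm{VP}$. *)

theory Defs
  imports
    "HOL-Library.Poly_Mapping"
    "HOL-Library.FuncSet"
    "HOL-Computational_Algebra.Polynomial"
    "HOL-Combinatorics.Permutations"
begin

section \<open>Multivariate polynomials\<close>

text \<open>
  A monomial is a finitely supported exponent function; the variable \<open>x\<^sub>i\<close> carries
  the index \<open>i\<close>, and variables are numbered from 1.
\<close>

type_synonym 'a mpoly = "(nat \<Rightarrow>\<^sub>0 nat) \<Rightarrow>\<^sub>0 'a"

definition CC :: "'a::zero \<Rightarrow> 'a mpoly" where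
  "CC a = Poly_Mapping.single 0 a"

definition XX :: "nat \<Rightarrow> 'a::zero_neq_one mpoly" where
  "XX i = Poly_Mapping.single (Poly_Mapping.single i 1) 1"

definition mvars :: "'a::zero mpoly \<Rightarrow> nat set" where
  "mvars p = (\<Union>m\<in>Poly_Mapping.keys p. Poly_Mapping.keys m)"

definition monom_degree :: "(nat \<Rightarrow>\<^sub>0 nat) \<Rightarrow> nat" where
  "monom_degree m = (\<Sum>i\<in>Poly_Mapping.keys m. Poly_Mapping.lookup m i)"

text \<open>The zero polynomial is given total degree 0.\<close>

definition total_deg :: "'a::zero mpoly \<Rightarrow> nat" where
  "total_deg p = Max (insert 0 (monom_degree ` Poly_Mapping.keys p))"

text \<open>The substitution \<open>x\<^sub>i \<mapsto> s i\<close>.\<close>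

definition msubst :: "(nat \<Rightarrow> 'a mpoly) \<Rightarrow> 'a::comm_ring_1 mpoly \<Rightarrow> 'a mpoly" where
  "msubst s p = (\<Sum>m\<in>Poly_Mapping.keys p.
     CC (Poly_Mapping.lookup p m) * (\<Prod>i\<in>Poly_Mapping.keys m. s i ^ Poly_Mapping.lookup m i))"


section \<open>Arithmetic circuits, VP and VNP\<close>

text \<open>
  A circuit is a list of gates in topological order: \<open>Add i j\<close> and \<open>Mul i j\<close> refer to
  the gates at (0-based) list positions \<open>i\<close> and \<open>j\<close>, which have to be earlier ones. Gates
  may be used several times. The output is the last gate, the size is the number of gates.
\<close>

datatype 'a gate = Input nat | Const 'a | Add nat nat | Mul nat nat

text \<open>The argument \<open>v\<close> is the number of variables and \<open>k\<close> the position of the gate.\<close>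

fun wf_gate :: "nat \<Rightarrow> nat \<Rightarrow> 'a gate \<Rightarrow> bool" where
  "wf_gate v k (Input i) \<longleftrightarrow> i \<in> {1..v}"
| "wf_gate v k (Const a) \<longleftrightarrow> True"
| "wf_gate v k (Add i j) \<longleftrightarrow> i < k \<and> j < k"
| "wf_gate v k (Mul i j) \<longleftrightarrow> i < k \<and> j < k"

definition wf_circuit :: "nat \<Rightarrow> 'a gate list \<Rightarrow> bool" where
  "wf_circuit v C \<longleftrightarrow> C \<noteq> [] \<and> (\<forall>k < length C. wf_gate v k (C ! k))"

fun gate_value :: "'a::comm_ring_1 mpoly list \<Rightarrow> 'a gate \<Rightarrow> 'a mpoly" where
  "gate_value ps (Input i) = XX i"
| "gate_value ps (Const a) = CC a"
| "gate_value ps (Add i j) = ps ! i + ps ! j"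
| "gate_value ps (Mul i j) = ps ! i * ps ! j"

definition circuit_values :: "'a::comm_ring_1 gate list \<Rightarrow> 'a mpoly list" where
  "circuit_values C = foldl (\<lambda>ps g. ps @ [gate_value ps g]) [] C"

definition computes :: "nat \<Rightarrow> 'a::comm_ring_1 gate list \<Rightarrow> 'a mpoly \<Rightarrow> bool" where
  "computes v C p \<longleftrightarrow> wf_circuit v C \<and> last (circuit_values C) = p"

definition poly_bounded :: "(nat \<Rightarrow> nat) \<Rightarrow> bool" where
  "poly_bounded f \<longleftrightarrow> (\<exists>q :: nat poly. \<forall>n. f n \<le> poly q n)"

text \<open>
  A family is given by the numbers \<open>v n\<close> of variables and by polynomials \<open>f n\<close> in the
  variables \<open>x\<^sub>1, \<dots>, x\<^bsub>v n\<^esub>\<close>. The classes are the nonuniform ones of Valiant: no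
  computability is asked of the map sending \<open>n\<close> to the circuit for \<open>f n\<close>.
\<close>

definition in_VP :: "(nat \<Rightarrow> nat) \<Rightarrow> (nat \<Rightarrow> 'a::field mpoly) \<Rightarrow> bool" where
  "in_VP v f \<longleftrightarrow>
     poly_bounded v \<and>
     (\<forall>n. mvars (f n) \<subseteq> {1..v n}) \<and>
     poly_bounded (\<lambda>n. total_deg (f n)) \<and>
     (\<exists>C. poly_bounded (\<lambda>n. length (C n)) \<and> (\<forall>n. computes (v n) (C n) (f n)))"

text \<open>
  \<open>boolean_sum v m f\<close> is \<open>\<Sum>\<^bsub>c\<in>{0,1}\<^sup>m\<^esub> f(x\<^sub>1, \<dots>, x\<^sub>v, c\<^sub>1, \<dots>, c\<^sub>m)\<close>: the last \<open>m\<close> of the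
  \<open>v + m\<close> variables of \<open>f\<close> are summed over.
\<close>

definition boolean_sum :: "nat \<Rightarrow> nat \<Rightarrow> 'a::field mpoly \<Rightarrow> 'a mpoly" where
  "boolean_sum v m f =
     (\<Sum>c \<in> {1..m} \<rightarrow>\<^sub>E {0, 1 :: 'a}. msubst (\<lambda>i. if i \<le> v then XX i else CC (c (i - v))) f)"

definition in_VNP :: "(nat \<Rightarrow> nat) \<Rightarrow> (nat \<Rightarrow> 'a::field mpoly) \<Rightarrow> bool" where
  "in_VNP v g \<longleftrightarrow>
     (\<forall>n. mvars (g n) \<subseteq> {1..v n}) \<and>
     (\<exists>m f. poly_bounded m \<and> in_VP (\<lambda>n. v n + m n) f \<and>
            (\<forall>n. g n = boolean_sum (v n) (m n) (f n)))"


section \<open>Bruhat order\<close>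

text \<open>
  Elements of \<open>S\<^sub>N\<close> are functions \<open>\<sigma>\<close> on \<open>nat\<close> with \<open>\<sigma> permutes {1..N}\<close>.
  Composing with a transposition of positions on the right exchanges the values there.
\<close>

definition inversions :: "nat \<Rightarrow> (nat \<Rightarrow> nat) \<Rightarrow> (nat \<times> nat) set" where
  "inversions N \<sigma> = {(i, j). 1 \<le> i \<and> i < j \<and> j \<le> N \<and> \<sigma> i > \<sigma> j}"

definition perm_length :: "nat \<Rightarrow> (nat \<Rightarrow> nat) \<Rightarrow> nat" where
  "perm_length N \<sigma> = card (inversions N \<sigma>)"

definition cover_at :: "nat \<Rightarrow> nat \<Rightarrow> nat \<Rightarrow> (nat \<Rightarrow> nat) \<Rightarrow> (nat \<Rightarrow> nat) \<Rightarrow> bool" where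
  "cover_at N s t \<sigma> \<pi> \<longleftrightarrow>
     \<sigma> permutes {1..N} \<and> 1 \<le> s \<and> s < t \<and> t \<le> N \<and>
     \<pi> = \<sigma> \<circ> transpose s t \<and> perm_length N \<pi> = perm_length N \<sigma> + 1"

definition bruhat_cover :: "nat \<Rightarrow> (nat \<Rightarrow> nat) \<Rightarrow> (nat \<Rightarrow> nat) \<Rightarrow> bool" where
  "bruhat_cover N \<sigma> \<pi> \<longleftrightarrow> (\<exists>s t. cover_at N s t \<sigma> \<pi>)"

definition bruhat_le :: "nat \<Rightarrow> (nat \<Rightarrow> nat) \<Rightarrow> (nat \<Rightarrow> nat) \<Rightarrow> bool" where
  "bruhat_le N = (bruhat_cover N)\<^sup>*\<^sup>*"

definition max_perm :: "nat \<Rightarrow> nat \<Rightarrow> nat" where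
  "max_perm N i = (if i \<in> {1..N} then N + 1 - i else i)"


section \<open>Labeled Bruhat order and skew Schubert polynomials\<close>

text \<open>
  An edge is a triple of its source, its label and its target. The target belongs to the
  edge because the source and the label do not determine it.
\<close>

type_synonym edge = "(nat \<Rightarrow> nat) \<times> (nat \<times> nat) \<times> (nat \<Rightarrow> nat)"

definition labeled_edges :: "nat \<Rightarrow> edge set" where
  "labeled_edges N = {(\<sigma>, (j, b), \<pi>) | \<sigma> j b \<pi>.
     \<exists>s t. cover_at N s t \<sigma> \<pi> \<and> s \<le> j \<and> j < t \<and> b = \<sigma> s}"

fun is_chain :: "nat \<Rightarrow> (nat \<Rightarrow> nat) \<Rightarrow> edge list \<Rightarrow> (nat \<Rightarrow> nat) \<Rightarrow> bool" where
  "is_chain N \<sigma> [] \<pi> \<longleftrightarrow> \<sigma> = \<pi>"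
| "is_chain N \<sigma> ((\<alpha>, l, \<beta>) # C) \<pi> \<longleftrightarrow>
     \<alpha> = \<sigma> \<and> (\<alpha>, l, \<beta>) \<in> labeled_edges N \<and> is_chain N \<beta> C \<pi>"

definition labels :: "edge list \<Rightarrow> (nat \<times> nat) list" where
  "labels C = map (\<lambda>(\<alpha>, l, \<beta>). l) C"

definition label_less :: "nat \<times> nat \<Rightarrow> nat \<times> nat \<Rightarrow> bool" where
  "label_less l l' \<longleftrightarrow> fst l < fst l' \<or> fst l = fst l' \<and> snd l < snd l'"

definition increasing_chains :: "nat \<Rightarrow> (nat \<Rightarrow> nat) \<Rightarrow> (nat \<Rightarrow> nat) \<Rightarrow> edge list set" where
  "increasing_chains N \<sigma> \<pi> = {C. is_chain N \<sigma> C \<pi> \<and> sorted_wrt label_less (labels C)}"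

definition label_count :: "edge list \<Rightarrow> nat \<Rightarrow> nat" where
  "label_count C i = length (filter (\<lambda>l. fst l = i) (labels C))"

text \<open>
  The \<open>i\<close>-th entry of \<open>(N-1, \<dots>, 1)\<close> is \<open>N - i\<close>. Lemma \<open>label_count_le\<close> below shows that
  the subtraction in the exponent does not truncate, and lemma \<open>finite_increasing_chains\<close>
  that the sum is finite.
\<close>

definition skew_schubert :: "nat \<Rightarrow> (nat \<Rightarrow> nat) \<Rightarrow> (nat \<Rightarrow> nat) \<Rightarrow> 'a::comm_ring_1 mpoly" where
  "skew_schubert N \<pi> \<sigma> =
     (\<Sum>C\<in>increasing_chains N \<sigma> \<pi>. \<Prod>i\<in>{1..<N}. XX i ^ ((N - i) - label_count C i))"

definition schubert :: "nat \<Rightarrow> (nat \<Rightarrow> nat) \<Rightarrow> 'a::comm_ring_1 mpoly" where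
  "schubert N \<sigma> = skew_schubert N (max_perm N) \<sigma>"


subsection \<open>Well-definedness\<close>

lemma finite_inversions: "finite (inversions N \<sigma>)"
  by (rule finite_subset[of _ "{1..N} \<times> {1..N}"]) (auto simp: inversions_def)

lemma finite_labeled_edges: "finite (labeled_edges N)"
proof (rule finite_subset)
  show "finite ({\<sigma>. \<sigma> permutes {1..N}} \<times> ({1..N} \<times> {1..N}) \<times> {\<sigma>. \<sigma> permutes {1..N}})"
    by (intro finite_cartesian_product finite_permutations) auto
  show "labeled_edges N \<subseteq>
      {\<sigma>. \<sigma> permutes {1..N}} \<times> ({1..N} \<times> {1..N}) \<times> {\<sigma>. \<sigma> permutes {1..N}}"
  proof
    fix e assume "e \<in> labeled_edges N"
    then obtain \<sigma> j b \<pi> s t where e: "e = (\<sigma>, (j, b), \<pi>)" and c: "cover_at N s t \<sigma> \<pi>"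
      and st: "s \<le> j" "j < t" "b = \<sigma> s"
      by (auto simp: labeled_edges_def)
    have s: "s \<in> {1..N}" "t \<in> {1..N}" "\<sigma> permutes {1..N}" using c by (auto simp: cover_at_def)
    have "\<pi> permutes {1..N}"
      using c s permutes_compose[OF permutes_swap_id[OF s(1,2)] s(3)] by (simp add: cover_at_def)
    moreover have "\<sigma> s \<in> {1..N}" using s permutes_in_image by metis
    ultimately show "e \<in> {\<sigma>. \<sigma> permutes {1..N}} \<times> ({1..N} \<times> {1..N}) \<times> {\<sigma>. \<sigma> permutes {1..N}}"
      using e s st c by (auto simp: cover_at_def)
  qed
qed

lemma is_chain_edges: "is_chain N \<sigma> C \<pi> \<Longrightarrow> set C \<subseteq> labeled_edges N"
  by (induction N \<sigma> C \<pi> rule: is_chain.induct) auto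

lemma sorted_labels_distinct: "sorted_wrt label_less (labels C) \<Longrightarrow> distinct C"
  by (induction C) (force simp: labels_def label_less_def)+

lemma finite_increasing_chains: "finite (increasing_chains N \<sigma> \<pi>)"
  by (rule finite_subset[OF _ finite_subset_distinct[OF finite_labeled_edges[of N]]])
     (auto simp: increasing_chains_def dest: is_chain_edges sorted_labels_distinct)

lemma cover_at_less:
  assumes "cover_at N s t \<sigma> \<pi>"
  shows "\<sigma> s < \<sigma> t"
proof (rule ccontr)
  assume "\<not> \<sigma> s < \<sigma> t"
  from assms have st: "1 \<le> s" "s < t" "t \<le> N" and \<pi>: "\<pi> = \<sigma> \<circ> transpose s t"
    and len: "perm_length N \<pi> = perm_length N \<sigma> + 1" and "\<sigma> permutes {1..N}"
    by (auto simp: cover_at_def)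
  then have "\<sigma> s \<noteq> \<sigma> t" by (metis permutes_inj injD less_irrefl)
  with \<open>\<not> \<sigma> s < \<sigma> t\<close> have gt: "\<sigma> t < \<sigma> s" by simp
  define \<tau> where "\<tau> = transpose s t"
  define \<phi> where "\<phi> = (\<lambda>(i, j). if s < i \<and> i < t \<or> s < j \<and> j < t then (i, j) else (\<tau> i, \<tau> j))"
  have inv: "\<tau> (\<tau> i) = i" for i by (simp add: \<tau>_def)
  have mid: "s < \<tau> i \<and> \<tau> i < t \<longleftrightarrow> s < i \<and> i < t" for i
    using st by (auto simp: \<tau>_def transpose_def)
  have "\<phi> (\<phi> p) = p" for p by (cases p) (simp add: \<phi>_def inv mid)
  then have "inj_on \<phi> (inversions N \<pi>)" by (metis inj_onI)
  moreover have "\<phi> ` inversions N \<pi> \<subseteq> inversions N \<sigma>"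
    using st gt by (auto simp: \<phi>_def inversions_def \<pi> \<tau>_def transpose_def split: if_splits)
  ultimately have "card (inversions N \<pi>) \<le> card (inversions N \<sigma>)"
    by (rule card_inj_on_le[OF _ _ finite_inversions])
  with len show False by (simp add: perm_length_def)
qed

lemma labels_simps: "labels [] = []" "labels ((\<alpha>, l, \<beta>) # C) = l # labels C"
  by (simp_all add: labels_def)

lemma label_count_Cons:
  "label_count ((\<alpha>, l, \<beta>) # C) i = (if fst l = i then Suc (label_count C i) else label_count C i)"
  by (simp add: label_count_def labels_simps)

lemma label_count_le_aux:
  assumes "is_chain N \<sigma> C \<pi>" "sorted_wrt label_less (labels C)"
    "\<And>l. l \<in> set (labels C) \<Longrightarrow> label_less (i, b0) l"
  shows "label_count C i \<le> card {p \<in> {i<..N}. b0 < \<sigma> p}"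
  using assms
proof (induction N \<sigma> C \<pi> arbitrary: b0 rule: is_chain.induct)
  case (1 N \<sigma> \<pi>)
  then show ?case by (simp add: label_count_def labels_simps)
next
  case (2 N \<sigma> \<alpha> l \<beta> C \<pi>)
  obtain j b where l: "l = (j, b)" by (cases l)
  from 2 obtain s t where c: "cover_at N s t \<sigma> \<beta>" and sj: "s \<le> j" "j < t" and b: "b = \<sigma> s"
    by (auto simp: labeled_edges_def l)
  have rest: "label_less l l'" if "l' \<in> set (labels C)" for l'
    using 2 that by (simp add: labels_simps)
  have less: "label_less (i, b0) (j, b)" using 2 by (simp add: labels_simps l)
  show ?case
  proof (cases "j = i")
    case False
    then have "i < j" using less by (auto simp: label_less_def)
    then have "\<forall>l'\<in>set (labels C). fst l' \<noteq> i"
      using rest by (force simp: label_less_def l)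
    then have "label_count C i = 0" by (simp add: label_count_def)
    then show ?thesis using False by (simp add: label_count_Cons l)
  next
    case True
    let ?A = "{p \<in> {i<..N}. b < \<beta> p}" and ?B = "{p \<in> {i<..N}. b0 < \<sigma> p}"
    have bb: "b0 < b" using less True by (simp add: label_less_def)
    have lt: "\<sigma> s < \<sigma> t" using c by (rule cover_at_less)
    have \<beta>: "\<beta> = \<sigma> \<circ> transpose s t" and tN: "t \<le> N" using c by (auto simp: cover_at_def)
    have IH: "label_count C i \<le> card ?A"
      using 2 rest by (auto simp: l True labels_simps)
    have "t \<notin> ?A" "insert t ?A \<subseteq> ?B"
      using bb lt tN sj True b by (auto simp: \<beta> transpose_def split: if_splits)
    then have "Suc (card ?A) \<le> card ?B"
      using card_mono[of ?B "insert t ?A"] by simp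
    then show ?thesis using IH True by (simp add: label_count_Cons l)
  qed
qed

lemma label_count_le:
  assumes "C \<in> increasing_chains N \<sigma> \<pi>"
  shows "label_count C i \<le> N - i"
proof -
  have "is_chain N \<sigma> C \<pi>" "sorted_wrt label_less (labels C)"
    using assms by (auto simp: increasing_chains_def)
  then show ?thesis
  proof (induction N \<sigma> C \<pi> rule: is_chain.induct)
    case (1 N \<sigma> \<pi>)
    then show ?case by (simp add: label_count_def labels_simps)
  next
    case (2 N \<sigma> \<alpha> l \<beta> C \<pi>)
    show ?case
    proof (cases "fst l < i")
      case True
      with 2 show ?thesis by (simp add: label_count_Cons labels_simps)
    next
      case False
      have "0 < snd l"
      proof -
        from 2 obtain s t where "cover_at N s t \<sigma> \<beta>" "snd l = \<sigma> s"
          by (auto simp: labeled_edges_def)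
        moreover from this have "\<sigma> s \<in> {1..N}"
          unfolding cover_at_def by (subst permutes_in_image) auto
        ultimately show ?thesis by simp
      qed
      then have "label_less (i, 0) l" using False by (auto simp: label_less_def)
      moreover have "\<forall>l'\<in>set (labels C). label_less l l'" using 2 by (simp add: labels_simps)
      ultimately have "label_less (i, 0) l'" if "l' \<in> set (labels ((\<alpha>, l, \<beta>) # C))" for l'
        using that by (force simp: labels_simps label_less_def)
      then have "label_count ((\<alpha>, l, \<beta>) # C) i \<le> card {p \<in> {i<..N}. 0 < \<sigma> p}"
        using 2 by (intro label_count_le_aux) auto
      also have "\<dots> \<le> card {i<..N}" by (intro card_mono) auto
      finally show ?thesis by simp
    qed
  qed
qed

end

theory Submission
  imports Defs
begin

text \<open>
  Read the pairs \<open>(i, b)\<close> lexicographically as points of time. An increasing chain is then a walk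
  through \<open>S\<^sub>N\<close> that at time \<open>(i, b)\<close> either stays or moves along an edge labeled \<open>(i, b)\<close>, so a
  chain is determined by the sequence of the permutations visited. The monomial of a chain is a
  product of local weights: staying at \<open>\<sigma>\<close> at time \<open>(i, b)\<close> costs \<open>x\<^sub>i\<close> if \<open>\<sigma>\<close> has the value
  \<open>b\<close> at a position right of \<open>i\<close>, everything else costs 1.
  Encode the visited permutations as 0-1-matrices. The weight of one step is a formula of polynomial
  size in the entries of two consecutive matrices, because covers \<open>\<sigma> \<lessdot> \<sigma>\<tau>\<^bsub>st\<^esub>\<close> are described by the
  absence of a position between \<open>s\<close> and \<open>t\<close> with a value between \<open>\<sigma>(s)\<close> and \<open>\<sigma>(t)\<close>. The product of
  the step weights, summed over all 0-1-matrices, is the skew Schubert polynomial.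
\<close>


section \<open>Substitution is a ring homomorphism\<close>

lemma CC_0 [simp]: "CC 0 = 0"
  by (simp add: CC_def)

lemma CC_1 [simp]: "CC 1 = 1"
  by (simp add: CC_def)

lemma CC_mult: "CC (a * b) = CC a * CC (b :: 'a::comm_ring_1)"
  by (simp add: CC_def mult_single)

lemma CC_add: "CC (a + b) = CC a + CC (b :: 'a::comm_ring_1)"
  by (simp add: CC_def single_add)

lemma CC_uminus: "CC (- a) = - CC (a :: 'a::comm_ring_1)"
  using CC_add[of a "- a"] by (simp add: eq_neg_iff_add_eq_0 add.commute)

definition monom_subst :: "(nat \<Rightarrow> 'a mpoly) \<Rightarrow> (nat \<Rightarrow>\<^sub>0 nat) \<Rightarrow> 'a::comm_ring_1 mpoly" where
  "monom_subst s m = (\<Prod>i\<in>Poly_Mapping.keys m. s i ^ Poly_Mapping.lookup m i)"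

text \<open>Exponents outside the support are 0 and contribute factors 1. A common index set for two
  monomials then makes additivity termwise.\<close>

lemma monom_subst_superset:
  assumes "finite A" "Poly_Mapping.keys m \<subseteq> A"
  shows "monom_subst s m = (\<Prod>i\<in>A. s i ^ Poly_Mapping.lookup m i)"
  unfolding monom_subst_def
  by (rule prod.mono_neutral_left) (use assms in \<open>auto simp: in_keys_iff\<close>)

lemma monom_subst_add: "monom_subst s (m + m') = monom_subst s m * monom_subst s m'"
proof -
  let ?A = "Poly_Mapping.keys m \<union> Poly_Mapping.keys m'"
  have "monom_subst s (m + m') = (\<Prod>i\<in>?A. s i ^ Poly_Mapping.lookup (m + m') i)"
    by (rule monom_subst_superset) (use keys_add[of m m'] in auto)
  also have "\<dots> = monom_subst s m * monom_subst s m'"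
    by (simp add: monom_subst_superset[of ?A] lookup_add power_add prod.distrib)
  finally show ?thesis .
qed

lemma msubst_superset:
  assumes "finite A" "Poly_Mapping.keys p \<subseteq> A"
  shows "msubst s p = (\<Sum>m\<in>A. CC (Poly_Mapping.lookup p m) * monom_subst s m)"
  unfolding msubst_def monom_subst_def[symmetric]
  by (rule sum.mono_neutral_left) (use assms in \<open>auto simp: in_keys_iff\<close>)

lemma msubst_0 [simp]: "msubst s 0 = 0"
  by (simp add: msubst_def)

lemma msubst_add: "msubst s (p + q) = msubst s p + msubst s q"
proof -
  let ?A = "Poly_Mapping.keys p \<union> Poly_Mapping.keys q"
  have "msubst s (p + q) = (\<Sum>m\<in>?A. CC (Poly_Mapping.lookup (p + q) m) * monom_subst s m)"
    by (rule msubst_superset) (use keys_add[of p q] in auto)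
  also have "\<dots> = msubst s p + msubst s q"
    by (simp add: msubst_superset[of ?A] lookup_add CC_add distrib_right sum.distrib)
  finally show ?thesis .
qed

lemma msubst_sum: "msubst s (\<Sum>x\<in>A. g x) = (\<Sum>x\<in>A. msubst s (g x))"
  by (induction A rule: infinite_finite_induct) (auto simp: msubst_add)

lemma msubst_single: "msubst s (Poly_Mapping.single m a) = CC a * monom_subst s m"
  by (simp add: msubst_superset[of "{m}"])

lemma msubst_CC [simp]: "msubst s (CC a) = CC a"
  by (simp add: CC_def[of a] msubst_single) (simp add: monom_subst_def CC_def)

lemma msubst_1 [simp]: "msubst s 1 = 1"
  using msubst_CC[of s 1] by simp

lemma msubst_XX [simp]: "msubst s (XX i) = s i"
  by (simp add: XX_def msubst_single monom_subst_def)

lemma poly_mapping_eq_sum_single: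
  "p = (\<Sum>m\<in>Poly_Mapping.keys p. Poly_Mapping.single m (Poly_Mapping.lookup p m))"
  by (rule poly_mapping_eqI)
     (auto simp: lookup_sum lookup_single when_def in_keys_iff sum.delta' cong: if_cong)

text \<open>Both sides are additive in \<open>p\<close> and in \<open>q\<close>, so it suffices to
  compare them on products of two single terms.\<close>

lemma msubst_mult: "msubst s (p * q) = msubst s p * msubst s q"
proof -
  let ?p = "\<lambda>m. Poly_Mapping.single m (Poly_Mapping.lookup p m)"
  let ?q = "\<lambda>m. Poly_Mapping.single m (Poly_Mapping.lookup q m)"
  have single: "msubst s (?p m * ?q m') = msubst s (?p m) * msubst s (?q m')" for m m'
    by (simp add: mult_single msubst_single monom_subst_add CC_mult mult_ac)
  have "msubst s (p * q) =
      msubst s ((\<Sum>m\<in>Poly_Mapping.keys p. ?p m) * (\<Sum>m\<in>Poly_Mapping.keys q. ?q m))"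
    by (simp flip: poly_mapping_eq_sum_single)
  also have "\<dots> = msubst s (\<Sum>m\<in>Poly_Mapping.keys p. ?p m) * msubst s (\<Sum>m\<in>Poly_Mapping.keys q. ?q m)"
    by (simp add: sum_product msubst_sum single)
  also have "\<dots> = msubst s p * msubst s q"
    by (simp flip: poly_mapping_eq_sum_single)
  finally show ?thesis .
qed

lemma msubst_prod: "msubst s (\<Prod>x\<in>A. g x) = (\<Prod>x\<in>A. msubst s (g x))"
  by (induction A rule: infinite_finite_induct) (auto simp: msubst_mult)

lemma msubst_diff: "msubst s (p - q) = msubst s p - msubst s q"
  using msubst_add[of s "p - q" q] by (simp add: algebra_simps)


section \<open>Variables and degree\<close>

lemma keys_CC: "Poly_Mapping.keys (CC a) \<subseteq> {0}"
  by (simp add: CC_def)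

lemma mvars_CC [simp]: "mvars (CC a) = {}"
  using keys_CC[of a] by (auto simp: mvars_def)

lemma mvars_XX: "mvars (XX i :: 'a::zero_neq_one mpoly) \<subseteq> {i}"
  by (auto simp: mvars_def XX_def)

lemma mvars_add: "mvars (p + q) \<subseteq> mvars p \<union> mvars q"
  using keys_add[of p q] by (auto simp: mvars_def)

lemma mvars_mult: "mvars (p * q) \<subseteq> mvars p \<union> mvars (q :: 'a::comm_ring_1 mpoly)"
proof
  fix i assume "i \<in> mvars (p * q)"
  then obtain m where m: "m \<in> Poly_Mapping.keys (p * q)" "i \<in> Poly_Mapping.keys m"
    by (auto simp: mvars_def)
  from m(1) obtain a b where "m = a + b" "a \<in> Poly_Mapping.keys p" "b \<in> Poly_Mapping.keys q"
    using keys_mult[of p q] by auto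
  then show "i \<in> mvars p \<union> mvars q"
    using m(2) keys_add[of a b] by (auto simp: mvars_def)
qed

lemma mvars_sum: "mvars (\<Sum>x\<in>A. g x) \<subseteq> (\<Union>x\<in>A. mvars (g x))"
  by (induction A rule: infinite_finite_induct)
     (auto simp: mvars_def[of 0] dest: subsetD[OF mvars_add])

lemma mvars_prod:
  "mvars (\<Prod>x\<in>A. g x :: 'a::comm_ring_1 mpoly) \<subseteq> (\<Union>x\<in>A. mvars (g x))"
  \<comment> \<open>The empty product is read as \<open>CC 1\<close>, so that
    \<open>mvars_CC\<close> shows it free of variables.\<close>
  by (induction A rule: infinite_finite_induct)
     (auto simp: CC_1[symmetric] simp del: CC_1 dest: subsetD[OF mvars_mult])

lemma mvars_power: "mvars (p ^ n) \<subseteq> mvars (p :: 'a::comm_ring_1 mpoly)"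
  by (induction n) (auto simp: CC_1[symmetric] simp del: CC_1 dest: subsetD[OF mvars_mult])

section \<open>Total degree\<close>

lemma monom_degree_superset:
  assumes "finite A" "Poly_Mapping.keys m \<subseteq> A"
  shows "monom_degree m = (\<Sum>i\<in>A. Poly_Mapping.lookup m i)"
  unfolding monom_degree_def
  by (rule sum.mono_neutral_left) (use assms in \<open>auto simp: in_keys_iff\<close>)

lemma monom_degree_add: "monom_degree (m + m') = monom_degree m + monom_degree m'"
proof -
  let ?A = "Poly_Mapping.keys m \<union> Poly_Mapping.keys m'"
  have "monom_degree (m + m') = (\<Sum>i\<in>?A. Poly_Mapping.lookup (m + m') i)"
    by (rule monom_degree_superset) (use keys_add[of m m'] in auto)
  also have "\<dots> = monom_degree m + monom_degree m'"
    by (simp add: monom_degree_superset[of ?A] lookup_add sum.distrib)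
  finally show ?thesis .
qed

lemma total_deg_le_iff:
  "total_deg p \<le> d \<longleftrightarrow> (\<forall>m\<in>Poly_Mapping.keys p. monom_degree m \<le> d)"
  by (auto simp: total_deg_def)

lemma total_deg_add: "total_deg (p + q) \<le> max (total_deg p) (total_deg q)"
proof -
  have "total_deg p \<le> max (total_deg p) (total_deg q)"
    "total_deg q \<le> max (total_deg p) (total_deg q)" by auto
  then show ?thesis
    using keys_add[of p q] unfolding total_deg_le_iff by blast
qed

lemma total_deg_mult: "total_deg (p * q) \<le> total_deg p + total_deg (q :: 'a::comm_ring_1 mpoly)"
  unfolding total_deg_le_iff
proof
  fix m assume "m \<in> Poly_Mapping.keys (p * q)"
  then obtain a b where "m = a + b" "a \<in> Poly_Mapping.keys p" "b \<in> Poly_Mapping.keys q"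
    using keys_mult[of p q] by auto
  moreover from this have "monom_degree a \<le> total_deg p" "monom_degree b \<le> total_deg q"
    using total_deg_le_iff by blast+
  ultimately show "monom_degree m \<le> total_deg p + total_deg q"
    by (simp add: monom_degree_add)
qed

lemma total_deg_CC: "total_deg (CC a) = 0"
  using total_deg_le_iff[of "CC a" 0] keys_CC[of a] by (auto simp: monom_degree_def)

lemma total_deg_XX: "total_deg (XX i :: 'a::comm_ring_1 mpoly) \<le> 1"
  by (simp add: total_deg_le_iff XX_def monom_degree_def)


section \<open>Formulas\<close>

fun shift_gate :: "nat \<Rightarrow> 'a gate \<Rightarrow> 'a gate" where
  "shift_gate k (Add i j) = Add (k + i) (k + j)"
| "shift_gate k (Mul i j) = Mul (k + i) (k + j)"
| "shift_gate k g = g"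

lemma circuit_values_Nil [simp]: "circuit_values [] = []"
  by (simp add: circuit_values_def)

lemma circuit_values_snoc [simp]:
  "circuit_values (C @ [g]) = circuit_values C @ [gate_value (circuit_values C) g]"
  by (simp add: circuit_values_def)

lemma length_circuit_values [simp]: "length (circuit_values C) = length C"
  by (induction C rule: rev_induct) auto

lemma circuit_values_eq_Nil: "circuit_values C = [] \<longleftrightarrow> C = []"
  by (metis length_0_conv length_circuit_values)

text \<open>Well-formed gates of \<open>D\<close> refer only to earlier gates of \<open>D\<close>,
  and behind \<open>C\<close> these sit exactly \<open>length C\<close> positions further
  on.\<close>

lemma circuit_values_append_shift:
  assumes "\<forall>k < length D. wf_gate v k (D ! k)"
  shows "circuit_values (C @ map (shift_gate (length C)) D) = circuit_values C @ circuit_values D"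
  using assms
proof (induction D rule: rev_induct)
  case (snoc g D)
  have "wf_gate v (length D) g"
    using snoc.prems[rule_format, of "length D"] by simp
  then have "gate_value (circuit_values C @ circuit_values D) (shift_gate (length C) g) =
      gate_value (circuit_values D) g"
    by (cases g) (simp_all add: nth_append)
  moreover have "\<forall>k < length D. wf_gate v k (D ! k)"
  proof (intro allI impI)
    fix k assume "k < length D"
    then show "wf_gate v k (D ! k)"
      using snoc.prems[rule_format, of k] by (simp add: nth_append)
  qed
  ultimately show ?case
    using snoc.IH by (simp flip: append_assoc)
qed simp

lemma wf_gate_shift: "wf_gate v k g \<Longrightarrow> wf_gate v (n + k) (shift_gate n g)"
  by (cases g) auto

lemma wf_circuit_snoc:
  assumes "\<And>k. k < length E \<Longrightarrow> wf_gate v k (E ! k)" "wf_gate v (length E) g"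
  shows "wf_circuit v (E @ [g])"
  using assms by (auto simp: wf_circuit_def nth_append less_Suc_eq)

text \<open>The two circuits are placed one behind the other without sharing, followed by one new
  gate reading their outputs, the last gates of the two blocks. The variable \<open>G\<close> treats
  sums and products at once.\<close>

lemma computes_binop:
  assumes C: "computes v C p" and D: "computes v D q"
    and G: "G = Add \<and> r = p + q \<or> G = Mul \<and> r = p * q"
  shows "computes v (C @ map (shift_gate (length C)) D @ [G (length C - 1) (length C + length D - 1)]) r"
proof -
  let ?E = "C @ map (shift_gate (length C)) D"
  let ?g = "G (length C - 1) (length C + length D - 1)"
  have ne: "C \<noteq> []" "D \<noteq> []" and wfC: "\<forall>k < length C. wf_gate v k (C ! k)"
    and wfD: "\<forall>k < length D. wf_gate v k (D ! k)"
    and p: "circuit_values C ! (length C - 1) = p" and q: "circuit_values D ! (length D - 1) = q"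
    using C D circuit_values_eq_Nil[of C] circuit_values_eq_Nil[of D]
    by (auto simp: computes_def wf_circuit_def last_conv_nth)
  have "wf_gate v k (?E ! k)" if "k < length ?E" for k
  proof (cases "k < length C")
    case True
    then show ?thesis using wfC by (simp add: nth_append)
  next
    case False
    then have "wf_gate v (length C + (k - length C)) (shift_gate (length C) (D ! (k - length C)))"
      using that wfD by (intro wf_gate_shift) auto
    then show ?thesis using False that by (simp add: nth_append)
  qed
  moreover have "wf_gate v (length ?E) ?g"
    using G ne by (auto simp: neq_Nil_conv)
  ultimately have "wf_circuit v (?E @ [?g])"
    by (intro wf_circuit_snoc) auto
  moreover have "circuit_values ?E ! (length C - 1) = p"
    "circuit_values ?E ! (length C + length D - 1) = q"
    using ne p q by (auto simp: circuit_values_append_shift[OF wfD] nth_append neq_Nil_conv)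
  then have "last (circuit_values (?E @ [?g])) = r"
    using G by (subst circuit_values_snoc) auto
  ultimately show ?thesis by (simp add: computes_def)
qed

text \<open>One number bounds both degree and circuit size, since both at most add up under the
  constructions below, apart from the cost of new gates. Circuits are always combined without
  sharing gates, hence the name.\<close>

definition has_formula :: "nat \<Rightarrow> nat \<Rightarrow> 'a::comm_ring_1 mpoly \<Rightarrow> bool" where
  "has_formula v s p \<longleftrightarrow>
     mvars p \<subseteq> {1..v} \<and> total_deg p \<le> s \<and> (\<exists>C. computes v C p \<and> length C \<le> s)"

lemma has_formula_mono: "has_formula v s p \<Longrightarrow> s \<le> s' \<Longrightarrow> has_formula v s' p"
  unfolding has_formula_def by (meson order_trans)

lemma has_formula_CC: "has_formula v 1 (CC a)"
proof -
  have "computes v [Const a] (CC a)"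
    by (simp add: computes_def wf_circuit_def circuit_values_def)
  then show ?thesis
    by (force simp: has_formula_def total_deg_CC)
qed

lemma has_formula_01: "has_formula v 1 0" "has_formula v 1 1"
  using has_formula_CC[of v 0] has_formula_CC[of v 1] by simp_all

lemma has_formula_XX: "i \<in> {1..v} \<Longrightarrow> has_formula v 1 (XX i)"
proof -
  assume i: "i \<in> {1..v}"
  then have "computes v [Input i] (XX i :: 'a mpoly)"
    by (simp add: computes_def wf_circuit_def circuit_values_def)
  moreover have "mvars (XX i :: 'a mpoly) \<subseteq> {1..v}"
    using mvars_XX[of i] i by auto
  ultimately show ?thesis
    using total_deg_XX[of i] by (force simp: has_formula_def)
qed

lemma has_formula_add:
  assumes "has_formula v s p" "has_formula v t q"
  shows "has_formula v (s + t + 1) (p + q)"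
proof -
  obtain C D where "computes v C p" "length C \<le> s" "computes v D q" "length D \<le> t"
    using assms by (auto simp: has_formula_def)
  then have "\<exists>E. computes v E (p + q) \<and> length E \<le> s + t + 1"
    using computes_binop[of v C p D q Add "p + q"] by (intro exI conjI) auto
  then show ?thesis
    using assms mvars_add[of p q] total_deg_add[of p q] unfolding has_formula_def by auto
qed

lemma has_formula_mult:
  assumes "has_formula v s p" "has_formula v t q"
  shows "has_formula v (s + t + 1) (p * q)"
proof -
  obtain C D where "computes v C p" "length C \<le> s" "computes v D q" "length D \<le> t"
    using assms by (auto simp: has_formula_def)
  then have "\<exists>E. computes v E (p * q) \<and> length E \<le> s + t + 1"
    using computes_binop[of v C p D q Mul "p * q"] by (intro exI conjI) auto
  then show ?thesis
    using assms mvars_mult[of p q] total_deg_mult[of p q] unfolding has_formula_def by auto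
qed

text \<open>There is no subtraction gate. The difference is computed as
  \<open>p + CC (- 1) * q\<close>, which costs the constant and two operations.\<close>

lemma has_formula_diff:
  assumes "has_formula v s p" "has_formula v t q"
  shows "has_formula v (s + t + 3) (p - q)"
  using has_formula_add[OF assms(1) has_formula_mult[OF has_formula_CC[of v "- 1"] assms(2)]]
  by (simp add: CC_uminus eval_nat_numeral)

text \<open>Each element adds its own formula and one gate; the final 1 is the constant of the empty
  sum. The bound \<open>k\<close> in place of \<open>card A\<close> keeps sizes independent of the
  actual index ranges.\<close>

lemma has_formula_sum:
  assumes "finite A" "card A \<le> k" "\<And>x. x \<in> A \<Longrightarrow> has_formula v s (g x)"
  shows "has_formula v (k * (s + 1) + 1) (\<Sum>x\<in>A. g x)"
proof -
  have "has_formula v (card A * (s + 1) + 1) (\<Sum>x\<in>A. g x)"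
    using assms(1,3)
  proof (induction A)
    case (insert x A)
    then show ?case
      using has_formula_add[of v s "g x" "card A * (s + 1) + 1" "\<Sum>x\<in>A. g x"]
      by (simp add: algebra_simps)
  qed (use has_formula_01 in simp)
  then show ?thesis
    by (rule has_formula_mono) (use assms(2) in \<open>simp add: add_mono\<close>)
qed

lemma has_formula_prod:
  assumes "finite A" "card A \<le> k" "\<And>x. x \<in> A \<Longrightarrow> has_formula v s (g x)"
  shows "has_formula v (k * (s + 1) + 1) (\<Prod>x\<in>A. g x)"
proof -
  have "has_formula v (card A * (s + 1) + 1) (\<Prod>x\<in>A. g x)"
    using assms(1,3)
  proof (induction A)
    case (insert x A)
    then show ?case
      using has_formula_mult[of v s "g x" "card A * (s + 1) + 1" "\<Prod>x\<in>A. g x"]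
      by (simp add: algebra_simps)
  qed (use has_formula_01 in simp)
  then show ?thesis
    by (rule has_formula_mono) (use assms(2) in \<open>simp add: add_mono\<close>)
qed

section \<open>Closure properties of polynomially bounded functions\<close>

lemma poly_bounded_mono: "poly_bounded g \<Longrightarrow> (\<And>n. f n \<le> g n) \<Longrightarrow> poly_bounded f"
  unfolding poly_bounded_def by (meson order_trans)

lemma poly_bounded_const: "poly_bounded (\<lambda>_. k)"
  unfolding poly_bounded_def by (intro exI[of _ "[:k:]"]) simp

lemma poly_bounded_id: "poly_bounded (\<lambda>n. n)"
  unfolding poly_bounded_def by (intro exI[of _ "[:0, 1:]"]) simp

lemma poly_bounded_add: "poly_bounded f \<Longrightarrow> poly_bounded g \<Longrightarrow> poly_bounded (\<lambda>n. f n + g n)"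
  unfolding poly_bounded_def
proof (elim exE)
  fix q r :: "nat poly"
  assume "\<forall>n. f n \<le> poly q n" "\<forall>n. g n \<le> poly r n"
  then show "\<exists>q. \<forall>n. f n + g n \<le> poly q n"
    by (intro exI[of _ "q + r"]) (simp add: add_mono)
qed

lemma poly_bounded_mult: "poly_bounded f \<Longrightarrow> poly_bounded g \<Longrightarrow> poly_bounded (\<lambda>n. f n * g n)"
  unfolding poly_bounded_def
proof (elim exE)
  fix q r :: "nat poly"
  assume "\<forall>n. f n \<le> poly q n" "\<forall>n. g n \<le> poly r n"
  then show "\<exists>q. \<forall>n. f n * g n \<le> poly q n"
    by (intro exI[of _ "q * r"]) (simp add: mult_le_mono)
qed

lemmas poly_bounded_intros =
  poly_bounded_const poly_bounded_id poly_bounded_add poly_bounded_mult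

text \<open>The classes are nonuniform, so the circuits may be picked by choice for each
  \<open>n\<close>, and \<open>s\<close> bounds their sizes as well as the degrees.\<close>

lemma in_VP_if_has_formula:
  assumes v: "poly_bounded v" and s: "poly_bounded s"
    and f: "\<And>n. has_formula (v n) (s n) (f n :: 'a::field mpoly)"
  shows "in_VP v f"
proof -
  have "\<forall>n. \<exists>C. computes (v n) C (f n) \<and> length C \<le> s n"
    using f by (auto simp: has_formula_def)
  then obtain C where C: "\<forall>n. computes (v n) (C n) (f n) \<and> length (C n) \<le> s n"
    by (rule choice[THEN exE])
  show ?thesis
    unfolding in_VP_def
  proof (intro conjI exI[of _ C])
    show "poly_bounded (\<lambda>n. length (C n))"
      using C by (intro poly_bounded_mono[OF s]) simp
    show "poly_bounded (\<lambda>n. total_deg (f n))"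
      using f by (intro poly_bounded_mono[OF s]) (simp add: has_formula_def)
  qed (use v f C in \<open>simp_all add: has_formula_def\<close>)
qed


section \<open>Bruhat covers\<close>

text \<open>If \<open>\<sigma> s < \<sigma> t\<close>, the involution \<open>\<phi>\<close> embeds
  the inversions of \<open>\<sigma>\<close> into those of the exchanged permutation. The image
  always misses \<open>(s, t)\<close>, and also \<open>(s, p)\<close> for every \<open>p\<close> in
  between with an intermediate value; without such a \<open>p\<close> nothing else is missed.
  Otherwise \<open>cover_at_less\<close> rules out a cover.\<close>

lemma cover_at_iff:
  assumes \<sigma>: "\<sigma> permutes {1..N}" and s: "1 \<le> s" and st: "s < t" and t: "t \<le> N"
  shows "cover_at N s t \<sigma> (\<sigma> \<circ> transpose s t) \<longleftrightarrow>
    \<sigma> s < \<sigma> t \<and> (\<forall>p. s < p \<and> p < t \<longrightarrow> \<not> (\<sigma> s < \<sigma> p \<and> \<sigma> p < \<sigma> t))"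
proof -
  define \<tau> where "\<tau> = transpose s t"
  define \<pi> where "\<pi> = \<sigma> \<circ> \<tau>"
  \<comment> \<open>Exchanging \<open>s\<close> and \<open>t\<close> in a pair could reverse its
    order if the other member lies between them. Such pairs are kept; when
    \<open>\<sigma> s < \<sigma> t\<close> they remain inversions, because the larger value moves to
    the left.\<close>
  define \<phi> where "\<phi> = (\<lambda>(i, j). if s < i \<and> i < t \<or> s < j \<and> j < t then (i, j) else (\<tau> i, \<tau> j))"
  have inv: "\<tau> (\<tau> i) = i" for i by (simp add: \<tau>_def)
  have mid: "s < \<tau> i \<and> \<tau> i < t \<longleftrightarrow> s < i \<and> i < t" for i
    using st by (auto simp: \<tau>_def transpose_def)
  have \<phi>\<phi>: "\<phi> (\<phi> p) = p" for p by (cases p) (simp add: \<phi>_def inv mid)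
  then have "inj \<phi>" by (metis injI)
  have eq_iff: "\<sigma> i = \<sigma> j \<longleftrightarrow> i = j" for i j
    using permutes_inj[OF \<sigma>] by (simp add: inj_eq)
  have cov: "cover_at N s t \<sigma> \<pi> \<longleftrightarrow> card (inversions N \<pi>) = card (inversions N \<sigma>) + 1"
    using assms by (simp add: cover_at_def \<pi>_def \<tau>_def perm_length_def)
  have card_\<phi>: "card (\<phi> ` inversions N \<sigma>) = card (inversions N \<sigma>)"
    by (rule card_image) (use \<open>inj \<phi>\<close> in \<open>auto intro: inj_on_subset\<close>)
  have "card (inversions N \<pi>) = card (inversions N \<sigma>) + 1 \<longleftrightarrow>
      (\<forall>p. s < p \<and> p < t \<longrightarrow> \<not> (\<sigma> s < \<sigma> p \<and> \<sigma> p < \<sigma> t))" if lt: "\<sigma> s < \<sigma> t"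
  proof -
    have sub: "\<phi> ` inversions N \<sigma> \<subseteq> inversions N \<pi>"
      using assms lt by (auto simp: \<phi>_def inversions_def \<pi>_def \<tau>_def transpose_def split: if_splits)
    have notin: "(s, t) \<notin> \<phi> ` inversions N \<sigma>"
    proof
      assume "(s, t) \<in> \<phi> ` inversions N \<sigma>"
      then have "\<phi> (s, t) \<in> inversions N \<sigma>" using \<phi>\<phi> by (metis imageE)
      then show False using st by (simp add: \<phi>_def inversions_def \<tau>_def)
    qed
    have st_in: "(s, t) \<in> inversions N \<pi>"
      using assms lt by (simp add: inversions_def \<pi>_def \<tau>_def)
    show ?thesis
    proof
      assume card: "card (inversions N \<pi>) = card (inversions N \<sigma>) + 1"
      show "\<forall>p. s < p \<and> p < t \<longrightarrow> \<not> (\<sigma> s < \<sigma> p \<and> \<sigma> p < \<sigma> t)"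
      proof (intro allI impI notI)
        fix p assume p: "s < p \<and> p < t" and v: "\<sigma> s < \<sigma> p \<and> \<sigma> p < \<sigma> t"
        have "(s, p) \<notin> \<phi> ` inversions N \<sigma>"
        proof
          assume "(s, p) \<in> \<phi> ` inversions N \<sigma>"
          then have "\<phi> (s, p) \<in> inversions N \<sigma>" using \<phi>\<phi> by (metis imageE)
          then show False using p v by (simp add: \<phi>_def inversions_def)
        qed
        moreover have "(s, p) \<in> inversions N \<pi>"
          using assms p v by (simp add: inversions_def \<pi>_def \<tau>_def transpose_def)
        ultimately have sub': "insert (s, p) (insert (s, t) (\<phi> ` inversions N \<sigma>)) \<subseteq> inversions N \<pi>"
          and "(s, p) \<notin> insert (s, t) (\<phi> ` inversions N \<sigma>)"
          using sub st_in p by auto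
        then have "card (insert (s, p) (insert (s, t) (\<phi> ` inversions N \<sigma>))) =
            card (inversions N \<sigma>) + 2"
          using notin by (simp add: card_\<phi> finite_inversions)
        then show False
          using card card_mono[OF finite_inversions sub'] by simp
      qed
    next
      assume none: "\<forall>p. s < p \<and> p < t \<longrightarrow> \<not> (\<sigma> s < \<sigma> p \<and> \<sigma> p < \<sigma> t)"
      have "inversions N \<pi> \<subseteq> insert (s, t) (\<phi> ` inversions N \<sigma>)"
      proof
        fix q assume "q \<in> inversions N \<pi>"
        then have "q = (s, t) \<or> \<phi> q \<in> inversions N \<sigma>"
        proof (cases q)
          case (Pair i j)
          have *: "\<sigma> p < \<sigma> s \<or> \<sigma> t < \<sigma> p" if "s < p" "p < t" for p
            using none that eq_iff[of p s] eq_iff[of p t] by (metis less_irrefl linorder_neqE_nat)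
          from \<open>q \<in> inversions N \<pi>\<close> show ?thesis
            using assms lt *[of i] *[of j]
            by (auto simp: Pair \<phi>_def inversions_def \<pi>_def \<tau>_def transpose_def split: if_splits)
        qed
        then show "q \<in> insert (s, t) (\<phi> ` inversions N \<sigma>)"
          using \<phi>\<phi> by (metis image_eqI insertCI)
      qed
      then have "inversions N \<pi> = insert (s, t) (\<phi> ` inversions N \<sigma>)"
        using sub st_in by blast
      then show "card (inversions N \<pi>) = card (inversions N \<sigma>) + 1"
        using notin card_\<phi> by (simp add: finite_inversions)
    qed
  qed
  moreover have "cover_at N s t \<sigma> \<pi> \<Longrightarrow> \<sigma> s < \<sigma> t"
    by (rule cover_at_less)
  ultimately show ?thesis
    using cov unfolding \<pi>_def \<tau>_def by blast
qed


section \<open>Increasing chains as walks\<close>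

text \<open>A list rather than a set: its order is the lexicographic one, so a suffix holds the
  labels still to come. First coordinates stop at \<open>N - 1\<close> because an edge labeled
  \<open>(j, b)\<close> needs \<open>j < t \<le> N\<close>.\<close>

definition label_grid :: "nat \<Rightarrow> (nat \<times> nat) list" where
  "label_grid N = List.product [1..<N] [1..<Suc N]"

lemma set_label_grid: "set (label_grid N) = {1..<N} \<times> {1..N}"
  by (auto simp: label_grid_def)

lemma length_label_grid: "length (label_grid N) = (N - 1) * N"
  by (simp add: label_grid_def)

lemma label_less_irrefl: "\<not> label_less l l"
  by (simp add: label_less_def)

lemma label_less_trans: "label_less l l' \<Longrightarrow> label_less l' l'' \<Longrightarrow> label_less l l''"
  by (auto simp: label_less_def)

lemma sorted_product:
  assumes "sorted_wrt (<) xs" "sorted_wrt (<) ys"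
  shows "sorted_wrt label_less (List.product xs ys)"
  using assms(1)
proof (induction xs)
  case (Cons x xs)
  have "sorted_wrt label_less (map (Pair x) ys)"
    using assms(2) by (simp add: sorted_wrt_map label_less_def)
  then show ?case
    using Cons by (simp add: sorted_wrt_append) (auto simp: label_less_def)
qed simp

lemma sorted_label_grid: "sorted_wrt label_less (label_grid N)"
  unfolding label_grid_def by (intro sorted_product sorted_wrt_upt)

lemma labeled_edge_cases:
  assumes "(\<sigma>, (i, b), \<pi>) \<in> labeled_edges N"
  obtains s t where "cover_at N s t \<sigma> \<pi>" "s \<le> i" "i < t" "b = \<sigma> s"
  using assms by (auto simp: labeled_edges_def)

lemma cover_at_permutes:
  assumes "cover_at N s t \<sigma> \<pi>"
  shows "\<pi> permutes {1..N}"
  using assms permutes_compose[OF permutes_swap_id[of s "{1..N}" t], of \<sigma>]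
  by (simp add: cover_at_def)

lemma labeled_edge_permutes: "(\<sigma>, l, \<pi>) \<in> labeled_edges N \<Longrightarrow> \<pi> permutes {1..N}"
  by (cases l) (auto elim!: labeled_edge_cases dest: cover_at_permutes)

lemma labeled_edge_in_grid:
  assumes "(\<sigma>, l, \<pi>) \<in> labeled_edges N"
  shows "l \<in> set (label_grid N)"
proof -
  obtain i b where l: "l = (i, b)" by (cases l)
  then obtain s t where c: "cover_at N s t \<sigma> \<pi>" "s \<le> i" "i < t" "b = \<sigma> s"
    using assms by (auto elim: labeled_edge_cases)
  moreover from this have "\<sigma> s \<in> {1..N}"
    unfolding cover_at_def by (subst permutes_in_image) auto
  ultimately show ?thesis
    by (auto simp: l set_label_grid cover_at_def)
qed

text \<open>For a suffix \<open>L\<close> of the grid these are the chains that remain possible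
  after the earlier labels have passed; the inductions run over \<open>L\<close>.\<close>

definition chains_in :: "nat \<Rightarrow> (nat \<Rightarrow> nat) \<Rightarrow> (nat \<times> nat) list \<Rightarrow> (nat \<Rightarrow> nat) \<Rightarrow> edge list set" where
  "chains_in N \<pi> L \<sigma> = {C \<in> increasing_chains N \<sigma> \<pi>. set (labels C) \<subseteq> set L}"

lemma chains_in_label_grid: "chains_in N \<pi> (label_grid N) \<sigma> = increasing_chains N \<sigma> \<pi>"
proof -
  have "set (labels C) \<subseteq> set (label_grid N)" if "C \<in> increasing_chains N \<sigma> \<pi>" for C
  proof -
    have "set C \<subseteq> labeled_edges N"
      using that is_chain_edges[of N \<sigma> C \<pi>] by (auto simp: increasing_chains_def)
    then show ?thesis
      by (fastforce simp: labels_def dest: labeled_edge_in_grid)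
  qed
  then show ?thesis by (auto simp: chains_in_def)
qed

lemma finite_chains_in: "finite (chains_in N \<pi> L \<sigma>)"
  using finite_increasing_chains by (auto simp: chains_in_def)

lemma chains_in_Nil: "chains_in N \<pi> [] \<sigma> = (if \<sigma> = \<pi> then {[]} else {})"
  by (auto simp: chains_in_def increasing_chains_def labels_def)

text \<open>Labels of a chain strictly increase and \<open>l\<close> precedes all of
  \<open>L\<close>, so \<open>l\<close> can occur only on the first edge; the rest of the chain then
  has its labels in \<open>L\<close>.\<close>

lemma chains_in_Cons:
  assumes L: "sorted_wrt label_less (l # L)"
  shows "chains_in N \<pi> (l # L) \<sigma> = chains_in N \<pi> L \<sigma> \<union>
    (\<Union>\<sigma>'\<in>{\<sigma>'. (\<sigma>, l, \<sigma>') \<in> labeled_edges N}. (#) (\<sigma>, l, \<sigma>') ` chains_in N \<pi> L \<sigma>')"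
    (is "?lhs = ?rhs")
proof
  have asym: "\<not> label_less a l" if "a \<in> set (l # L)" for a
    using L that by (auto simp: label_less_def)
  show "?lhs \<subseteq> ?rhs"
  proof
    fix C assume C: "C \<in> ?lhs"
    show "C \<in> ?rhs"
    proof (cases "l \<in> set (labels C)")
      case False
      then show ?thesis using C by (auto simp: chains_in_def)
    next
      case True
      then obtain \<alpha> l' \<beta> D where CD: "C = (\<alpha>, l', \<beta>) # D"
        by (cases C) (auto simp: labels_def)
      have "l' = l"
        using C True asym[of l'] by (auto simp: CD chains_in_def increasing_chains_def labels_simps)
      then have "l \<notin> set (labels D)"
        using C by (auto simp: CD chains_in_def increasing_chains_def labels_simps label_less_def)
      then have "(\<sigma>, l, \<beta>) \<in> labeled_edges N" "C \<in> (#) (\<sigma>, l, \<beta>) ` chains_in N \<pi> L \<beta>"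
        using C \<open>l' = l\<close> by (auto simp: CD chains_in_def increasing_chains_def labels_simps)
      then show ?thesis by blast
    qed
  qed
  show "?rhs \<subseteq> ?lhs"
    using L by (auto simp: chains_in_def increasing_chains_def labels_simps) (meson subsetD)
qed

definition stay_exp :: "nat \<Rightarrow> nat \<times> nat \<Rightarrow> (nat \<Rightarrow> nat) \<Rightarrow> nat" where
  "stay_exp N l \<sigma> = of_bool (\<exists>p\<in>{fst l<..N}. \<sigma> p = snd l)"

text \<open>An edge raises the length, so at most one of the two summands is nonzero.\<close>

definition step_weight ::
    "nat \<Rightarrow> (nat \<Rightarrow> 'r) \<Rightarrow> nat \<times> nat \<Rightarrow> (nat \<Rightarrow> nat) \<Rightarrow> (nat \<Rightarrow> nat) \<Rightarrow> 'r::comm_ring_1" where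
  "step_weight N x l \<sigma> \<sigma>' =
     (if \<sigma>' = \<sigma> then x (fst l) ^ stay_exp N l \<sigma> else 0) + of_bool ((\<sigma>, l, \<sigma>') \<in> labeled_edges N)"

text \<open>When the labels are exhausted, the last clause tests whether the walk has arrived at
  \<open>\<pi>\<close>. Lists of different lengths also fall under it, but do not occur in the sums
  below.\<close>

fun walk_weight ::
    "nat \<Rightarrow> (nat \<Rightarrow> 'r) \<Rightarrow> (nat \<Rightarrow> nat) \<Rightarrow> (nat \<times> nat) list \<Rightarrow> (nat \<Rightarrow> nat) \<Rightarrow>
      (nat \<Rightarrow> nat) list \<Rightarrow> 'r::comm_ring_1" where
  "walk_weight N x \<pi> (l # L) \<sigma> (\<sigma>' # \<rho>) = step_weight N x l \<sigma> \<sigma>' * walk_weight N x \<pi> L \<sigma>' \<rho>"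
| "walk_weight N x \<pi> _ \<sigma> _ = of_bool (\<sigma> = \<pi>)"

text \<open>The exponent of \<open>x\<^sub>i\<close> collected by \<open>C\<close> when read as a
  walk over the times in \<open>L\<close>: a time that is not the label of the next edge is a stay
  and pays \<open>stay_exp\<close>.\<close>

fun free_exp :: "nat \<Rightarrow> (nat \<times> nat) list \<Rightarrow> (nat \<Rightarrow> nat) \<Rightarrow> edge list \<Rightarrow> nat \<Rightarrow> nat" where
  "free_exp N [] \<sigma> C i = 0"
| "free_exp N (l # L) \<sigma> C i =
     (if C \<noteq> [] \<and> fst (snd (hd C)) = l then free_exp N L (snd (snd (hd C))) (tl C) i
      else (if fst l = i then stay_exp N l \<sigma> else 0) + free_exp N L \<sigma> C i)"

declare free_exp.simps(2) [simp del]

lemma free_exp_stay: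
  "l \<notin> set (labels C) \<Longrightarrow>
    free_exp N (l # L) \<sigma> C i = (if fst l = i then stay_exp N l \<sigma> else 0) + free_exp N L \<sigma> C i"
  by (cases C) (auto simp: free_exp.simps(2) labels_simps)

lemma free_exp_move [simp]:
  "free_exp N (l # L) \<sigma> ((\<sigma>, l, \<sigma>') # D) i = free_exp N L \<sigma>' D i"
  by (simp add: free_exp.simps(2))

lemma sum_lists_length_Suc:
  assumes "finite S"
  shows "(\<Sum>xs\<in>{xs. set xs \<subseteq> S \<and> length xs = Suc n}. g xs) =
    (\<Sum>x\<in>S. \<Sum>xs\<in>{xs. set xs \<subseteq> S \<and> length xs = n}. g (x # xs))"
proof -
  let ?B = "{xs. set xs \<subseteq> S \<and> length xs = n}"
  have "{xs. set xs \<subseteq> S \<and> length xs = Suc n} = (\<lambda>(x, xs). x # xs) ` (S \<times> ?B)"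
    by (auto simp: length_Suc_conv image_iff)
  moreover have "inj_on (\<lambda>(x, xs). x # xs) (S \<times> ?B)"
    by (auto simp: inj_on_def)
  ultimately have "(\<Sum>xs\<in>{xs. set xs \<subseteq> S \<and> length xs = Suc n}. g xs) =
      (\<Sum>(x, xs)\<in>S \<times> ?B. g (x # xs))"
    by (simp add: sum.reindex case_prod_unfold)
  then show ?thesis
    by (simp add: sum.cartesian_product)
qed

text \<open>Splitting off the first permutation visited matches \<open>chains_in_Cons\<close>:
  staying accounts for the chains that avoid \<open>l\<close>, moving for those that start with an
  edge labeled \<open>l\<close>. The index set \<open>I\<close> stays fixed while \<open>L\<close>
  shrinks.\<close>

lemma sum_walk_weight:
  assumes "sorted_wrt label_less L" "fst ` set L \<subseteq> I" "finite I" "\<sigma> permutes {1..N}"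
  shows "(\<Sum>\<rho>\<in>{\<rho>. set \<rho> \<subseteq> {\<sigma>. \<sigma> permutes {1..N}} \<and> length \<rho> = length L}. walk_weight N x \<pi> L \<sigma> \<rho>) =
    (\<Sum>C\<in>chains_in N \<pi> L \<sigma>. \<Prod>i\<in>I. x i ^ free_exp N L \<sigma> C i)"
  using assms
proof (induction L arbitrary: \<sigma>)
  case Nil
  have "{\<rho>. set \<rho> \<subseteq> {\<sigma>. \<sigma> permutes {1..N}} \<and> \<rho> = []} = {[]}" by auto
  then show ?case by (simp add: chains_in_Nil)
next
  case (Cons l L)
  let ?S = "{\<sigma>. \<sigma> permutes {1..N}}"
  let ?E = "{\<sigma>'. (\<sigma>, l, \<sigma>') \<in> labeled_edges N}"
  define Z where "Z = (\<lambda>\<sigma>. \<Sum>C\<in>chains_in N \<pi> L \<sigma>. \<Prod>i\<in>I. x i ^ free_exp N L \<sigma> C i)"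
  let ?w = "\<lambda>C. \<Prod>i\<in>I. x i ^ free_exp N (l # L) \<sigma> C i"
  have fS: "finite ?S" by (rule finite_permutations) simp
  have ES: "?E \<subseteq> ?S" by (blast dest: labeled_edge_permutes)
  have nl: "l \<notin> set (labels C)" if "C \<in> chains_in N \<pi> L \<sigma>" for C \<sigma>
    using Cons.prems(1) that by (auto simp: chains_in_def label_less_def)
  have IH: "(\<Sum>\<rho>\<in>{\<rho>. set \<rho> \<subseteq> ?S \<and> length \<rho> = length L}. walk_weight N x \<pi> L \<sigma>' \<rho>) = Z \<sigma>'"
    if "\<sigma>' \<in> ?S" for \<sigma>'
    using Cons.IH[of \<sigma>'] Cons.prems that by (simp add: Z_def)
  have "(\<Sum>\<rho>\<in>{\<rho>. set \<rho> \<subseteq> ?S \<and> length \<rho> = length (l # L)}. walk_weight N x \<pi> (l # L) \<sigma> \<rho>) =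
      (\<Sum>\<sigma>'\<in>?S. step_weight N x l \<sigma> \<sigma>' * Z \<sigma>')"
    unfolding length_Cons sum_lists_length_Suc[OF fS] walk_weight.simps sum_distrib_left[symmetric]
    by (intro sum.cong refl) (simp only: IH)
  also have "\<dots> = (\<Sum>\<sigma>'\<in>?S. (if \<sigma>' = \<sigma> then x (fst l) ^ stay_exp N l \<sigma> * Z \<sigma> else 0)
      + (if \<sigma>' \<in> ?E then Z \<sigma>' else 0))"
    by (rule sum.cong) (auto simp: step_weight_def algebra_simps)
  also have "\<dots> = x (fst l) ^ stay_exp N l \<sigma> * Z \<sigma> + (\<Sum>\<sigma>'\<in>?E. Z \<sigma>')"
    using fS ES Cons.prems(4) by (simp add: sum.distrib sum.If_cases Int_absorb1)
  also have "x (fst l) ^ stay_exp N l \<sigma> * Z \<sigma> = (\<Sum>C\<in>chains_in N \<pi> L \<sigma>. ?w C)"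
    unfolding Z_def sum_distrib_left
  proof (rule sum.cong[OF refl])
    fix C assume "C \<in> chains_in N \<pi> L \<sigma>"
    note nl = nl[OF this]
    \<comment> \<open>Staying at time \<open>l\<close> raises only the exponent at
      \<open>fst l\<close>, and this index belongs to \<open>I\<close>.\<close>
    have "?w C = (\<Prod>i\<in>I. x i ^ (if fst l = i then stay_exp N l \<sigma> else 0)) *
        (\<Prod>i\<in>I. x i ^ free_exp N L \<sigma> C i)"
      by (simp add: free_exp_stay[OF nl] power_add prod.distrib)
    also have "(\<Prod>i\<in>I. x i ^ (if fst l = i then stay_exp N l \<sigma> else 0)) =
        (\<Prod>i\<in>I. if fst l = i then x i ^ stay_exp N l \<sigma> else 1)"
      by (rule prod.cong) auto
    also have "\<dots> = x (fst l) ^ stay_exp N l \<sigma>"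
      using Cons.prems(2,3) by simp
    finally show "x (fst l) ^ stay_exp N l \<sigma> * (\<Prod>i\<in>I. x i ^ free_exp N L \<sigma> C i) = ?w C"
      by simp
  qed
  also have "(\<Sum>\<sigma>'\<in>?E. Z \<sigma>') = (\<Sum>\<sigma>'\<in>?E. \<Sum>C\<in>(#) (\<sigma>, l, \<sigma>') ` chains_in N \<pi> L \<sigma>'. ?w C)"
    unfolding Z_def by (rule sum.cong[OF refl], subst sum.reindex) simp_all
  \<comment> \<open>The first edges differ in their targets, so the images are disjoint.\<close>
  also have "\<dots> = (\<Sum>C\<in>(\<Union>\<sigma>'\<in>?E. (#) (\<sigma>, l, \<sigma>') ` chains_in N \<pi> L \<sigma>'). ?w C)"
    using finite_subset[OF ES fS] by (intro sum.UNION_disjoint[symmetric]) (auto simp: finite_chains_in)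
  \<comment> \<open>The two parts are disjoint because only the second kind of chain uses
    \<open>l\<close>.\<close>
  also have "(\<Sum>C\<in>chains_in N \<pi> L \<sigma>. ?w C) + \<dots> = (\<Sum>C\<in>chains_in N \<pi> (l # L) \<sigma>. ?w C)"
    unfolding chains_in_Cons[OF Cons.prems(1)]
    by (rule sum.union_disjoint[symmetric])
       (use finite_subset[OF ES fS] in \<open>auto simp: finite_chains_in labels_simps dest: nl\<close>)
  finally show ?case .
qed

text \<open>Once \<open>(i, b)\<close> has been passed, the value \<open>b\<close> keeps its position until the labels \<open>(i, _)\<close> are
  exhausted, and it lies right of position \<open>i\<close> if \<open>(i, b)\<close> was used. So each of the \<open>N - i\<close> values
  that end up right of \<open>i\<close> contributes either a factor \<open>x\<^sub>i\<close> or a label.\<close>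

lemma free_exp_add_label_count:
  assumes "sorted_wrt label_less L" "set L \<subseteq> set (label_grid N)"
    "\<And>l l'. l \<in> set L \<Longrightarrow> l' \<in> set (label_grid N) \<Longrightarrow> label_less l l' \<Longrightarrow> l' \<in> set L"
    "\<sigma> permutes {1..N}" "C \<in> chains_in N \<pi> L \<sigma>" "i \<in> {1..<N}"
  shows "free_exp N L \<sigma> C i + label_count C i = card {p \<in> {i<..N}. (i, \<sigma> p) \<in> set L}"
  using assms
proof (induction L arbitrary: \<sigma> C)
  case Nil
  then show ?case by (auto simp: chains_in_def label_count_def labels_def)
next
  case (Cons l L)
  obtain j b where l: "l = (j, b)" by (cases l)
  then have fl: "fst l = j" "snd l = b" by simp_all
  have lL: "l \<notin> set L" and less: "\<And>l'. l' \<in> set L \<Longrightarrow> label_less l l'"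
    using Cons.prems(1) by (auto simp: label_less_def)
  \<comment> \<open>Since \<open>l # L\<close> is sorted and upward closed in the grid,
    \<open>L\<close> consists exactly of the grid labels above \<open>l\<close>.\<close>
  have mem: "l' \<in> set L \<longleftrightarrow> l' \<in> set (label_grid N) \<and> label_less l l'" for l'
    using Cons.prems(2) Cons.prems(3)[of l l'] less[of l'] label_less_irrefl[of l] by auto
  have up: "l'' \<in> set L" if "l' \<in> set L" "l'' \<in> set (label_grid N)" "label_less l' l''" for l' l''
    using that less[OF that(1)] label_less_trans[of l l' l''] by (simp add: mem)
  have IH: "free_exp N L \<sigma>' D i + label_count D i = card {p \<in> {i<..N}. (i, \<sigma>' p) \<in> set L}"
    if "\<sigma>' permutes {1..N}" "D \<in> chains_in N \<pi> L \<sigma>'" for \<sigma>' D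
    using Cons.IH[of \<sigma>' D] Cons.prems up that by auto
  have range: "\<sigma>' p \<in> {1..N}" if "\<sigma>' permutes {1..N}" "p \<in> {i<..N}" for \<sigma>' p
    using that Cons.prems(6) by (subst permutes_in_image) auto
  consider "C \<in> chains_in N \<pi> L \<sigma>"
    | \<sigma>' D where "(\<sigma>, l, \<sigma>') \<in> labeled_edges N" "C = (\<sigma>, l, \<sigma>') # D" "D \<in> chains_in N \<pi> L \<sigma>'"
    using Cons.prems(5) unfolding chains_in_Cons[OF Cons.prems(1)] by auto
  then show ?case
  proof cases
    case 1
    then have nl: "l \<notin> set (labels C)"
      using lL by (auto simp: chains_in_def)
    have *: "free_exp N (l # L) \<sigma> C i + label_count C i =
        (if j = i then stay_exp N l \<sigma> else 0) + card {p \<in> {i<..N}. (i, \<sigma> p) \<in> set L}"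
      using IH[OF Cons.prems(4) 1] free_exp_stay[OF nl, of N L \<sigma> i] by (simp add: fl)
    show ?thesis
    proof (cases "j = i \<and> (\<exists>p\<in>{i<..N}. \<sigma> p = b)")
      case False
      then have "{p \<in> {i<..N}. (i, \<sigma> p) \<in> set (l # L)} = {p \<in> {i<..N}. (i, \<sigma> p) \<in> set L}"
        by (auto simp: l)
      then show ?thesis using False by (auto simp: * stay_exp_def fl)
    next
      case True
      then obtain p where p: "j = i" "p \<in> {i<..N}" "\<sigma> p = b" by auto
      \<comment> \<open>The value \<open>b\<close> sits right of \<open>i\<close>, so its position
        leaves the counted set while staying pays one factor.\<close>
      have "{p \<in> {i<..N}. (i, \<sigma> p) \<in> set (l # L)} = insert p {p \<in> {i<..N}. (i, \<sigma> p) \<in> set L}"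
        using p permutes_inj[OF Cons.prems(4)] by (auto simp: l inj_eq)
      moreover have "p \<notin> {p \<in> {i<..N}. (i, \<sigma> p) \<in> set L}"
        using p lL by (simp add: l)
      ultimately show ?thesis using True by (simp add: * stay_exp_def fl)
    qed
  next
    case 2
    obtain s t where c: "cover_at N s t \<sigma> \<sigma>'" and st: "s \<le> j" "j < t" "b = \<sigma> s"
      using 2(1) by (auto simp: l elim: labeled_edge_cases)
    have \<sigma>': "\<sigma>' = \<sigma> \<circ> transpose s t" and t: "t \<le> N" using c by (auto simp: cover_at_def)
    have lt: "\<sigma> s < \<sigma> t" using c by (rule cover_at_less)
    have p\<sigma>': "\<sigma>' permutes {1..N}" using c by (rule cover_at_permutes)
    have *: "free_exp N (l # L) \<sigma> C i + label_count C i =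
        card {p \<in> {i<..N}. (i, \<sigma>' p) \<in> set L} + of_bool (j = i)"
      using IH[OF p\<sigma>' 2(3)] by (simp add: 2(2) fl label_count_Cons)
    have inj: "\<sigma> p = \<sigma> q \<longleftrightarrow> p = q" for p q
      using permutes_inj[OF Cons.prems(4)] by (simp add: inj_eq)
    show ?thesis
    proof (cases "j = i")
      case False
      \<comment> \<open>All grid labels \<open>(i, _)\<close> come after \<open>l\<close> if
        \<open>j < i\<close> and before it if \<open>i < j\<close>, so both sets are full or both
        are empty.\<close>
      then have "{p \<in> {i<..N}. (i, \<sigma> p) \<in> set (l # L)} = {p \<in> {i<..N}. (i, \<sigma>' p) \<in> set L}"
        using range[OF p\<sigma>'] range[OF Cons.prems(4)] Cons.prems(6)
        by (auto simp: l mem label_less_def set_label_grid)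
      then show ?thesis using False by (simp add: *)
    next
      case True
      \<comment> \<open>Counted are the positions right of \<open>i\<close> with values at least
        \<open>b\<close> before the move and above \<open>b\<close> after it. As
        \<open>s \<le> i < t\<close>, the exchange changes only position \<open>t\<close> there: its
        value drops to \<open>b\<close>, and the label makes up for the loss.\<close>
      have "{p \<in> {i<..N}. (i, \<sigma> p) \<in> set (l # L)} =
          insert t {p \<in> {i<..N}. (i, \<sigma>' p) \<in> set L}"
        using st t lt True Cons.prems(6) range[OF Cons.prems(4)]
        by (auto simp: l mem label_less_def set_label_grid \<sigma>' transpose_def inj split: if_splits)
      moreover have "t \<notin> {p \<in> {i<..N}. (i, \<sigma>' p) \<in> set L}"
        using st True by (auto simp: mem l label_less_def \<sigma>')
      ultimately show ?thesis using True by (simp add: *)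
    qed
  qed
qed

text \<open>For the whole grid every position right of \<open>i\<close> is counted, so the collected
  exponent is exactly \<open>(N - i) - label_count C i\<close>.\<close>

lemma skew_schubert_eq_walk_sum:
  assumes "\<sigma> permutes {1..N}"
  shows "skew_schubert N \<pi> \<sigma> =
    (\<Sum>\<rho>\<in>{\<rho>. set \<rho> \<subseteq> {\<sigma>. \<sigma> permutes {1..N}} \<and> length \<rho> = length (label_grid N)}.
       walk_weight N XX \<pi> (label_grid N) \<sigma> \<rho>)"
proof -
  have exp: "(N - i) - label_count C i = free_exp N (label_grid N) \<sigma> C i"
    if "C \<in> increasing_chains N \<sigma> \<pi>" "i \<in> {1..<N}" for C i
  proof -
    have "free_exp N (label_grid N) \<sigma> C i + label_count C i =
        card {p \<in> {i<..N}. (i, \<sigma> p) \<in> set (label_grid N)}"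
      using that assms by (intro free_exp_add_label_count)
        (auto simp: sorted_label_grid chains_in_label_grid)
    moreover have "\<sigma> p \<in> {1..N}" if "p \<in> {i<..N}" for p
      using that assms \<open>i \<in> {1..<N}\<close> by (subst permutes_in_image) auto
    then have "{p \<in> {i<..N}. (i, \<sigma> p) \<in> set (label_grid N)} = {i<..N}"
      using that by (auto simp: set_label_grid)
    ultimately show ?thesis by simp
  qed
  have "skew_schubert N \<pi> \<sigma> = (\<Sum>C\<in>chains_in N \<pi> (label_grid N) \<sigma>.
      \<Prod>i\<in>{1..<N}. XX i ^ free_exp N (label_grid N) \<sigma> C i)"
    unfolding skew_schubert_def chains_in_label_grid by (intro sum.cong prod.cong refl) (simp only: exp)
  also have "\<dots> = (\<Sum>\<rho>\<in>{\<rho>. set \<rho> \<subseteq> {\<sigma>. \<sigma> permutes {1..N}} \<and> length \<rho> = length (label_grid N)}.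
       walk_weight N XX \<pi> (label_grid N) \<sigma> \<rho>)"
    using assms by (intro sum_walk_weight[symmetric]) (auto simp: sorted_label_grid set_label_grid)
  finally show ?thesis .
qed


section \<open>Walks in terms of permutation matrices\<close>

definition perm_matrix :: "nat \<Rightarrow> (nat \<Rightarrow> nat) \<Rightarrow> nat \<Rightarrow> nat \<Rightarrow> 'r::comm_ring_1" where
  "perm_matrix N \<sigma> p w = of_bool (p \<in> {1..N} \<and> w \<in> {1..N} \<and> \<sigma> p = w)"

text \<open>Vanishing outside the square makes equality as functions the same as equality of the
  entries inside.\<close>

definition zero_one_matrix :: "nat \<Rightarrow> (nat \<Rightarrow> nat \<Rightarrow> 'r::comm_ring_1) \<Rightarrow> bool" where
  "zero_one_matrix N u \<longleftrightarrow>
     (\<forall>p w. u p w \<in> {0, 1}) \<and> (\<forall>p w. p \<notin> {1..N} \<or> w \<notin> {1..N} \<longrightarrow> u p w = 0)"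

text \<open>On 0-1 entries \<open>a * b + (1 - a) * (1 - b)\<close> indicates \<open>a = b\<close>.
  If \<open>u\<close> is the matrix of \<open>\<sigma>\<close>, reindexing by \<open>\<tau>\<close>
  compares \<open>u'\<close> with the matrix of \<open>\<sigma> \<circ> \<tau>\<close>.\<close>

definition eq_poly ::
    "nat \<Rightarrow> (nat \<Rightarrow> nat) \<Rightarrow> (nat \<Rightarrow> nat \<Rightarrow> 'r) \<Rightarrow> (nat \<Rightarrow> nat \<Rightarrow> 'r) \<Rightarrow> 'r::comm_ring_1" where
  "eq_poly N \<tau> u u' =
     (\<Prod>p\<in>{1..N}. \<Prod>w\<in>{1..N}. u (\<tau> p) w * u' p w + (1 - u (\<tau> p) w) * (1 - u' p w))"

text \<open>The criterion \<open>cover_at_iff\<close> in matrix entries, with \<open>b\<close> the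
  value at \<open>s\<close> and \<open>a\<close> running through the possible larger values at
  \<open>t\<close>.\<close>

definition cover_poly :: "nat \<Rightarrow> nat \<Rightarrow> (nat \<Rightarrow> nat \<Rightarrow> 'r) \<Rightarrow> nat \<Rightarrow> nat \<Rightarrow> 'r::comm_ring_1" where
  "cover_poly N b u s t =
     u s b * (\<Sum>a\<in>{b<..N}. u t a * (\<Prod>p\<in>{s<..<t}. \<Prod>w\<in>{b<..<a}. 1 - u p w))"

text \<open>The matrix version of \<open>step_weight\<close>. The sum over \<open>p\<close> locates
  the value \<open>snd l\<close> to decide whether staying costs a variable; the double sum runs
  over the exchanges that the label admits.\<close>

definition step_poly ::
    "nat \<Rightarrow> (nat \<Rightarrow> 'r) \<Rightarrow> nat \<times> nat \<Rightarrow> (nat \<Rightarrow> nat \<Rightarrow> 'r) \<Rightarrow> (nat \<Rightarrow> nat \<Rightarrow> 'r) \<Rightarrow> 'r::comm_ring_1" where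
  "step_poly N x l u u' =
     eq_poly N id u u' * (\<Sum>p\<in>{1..N}. u p (snd l) * (if fst l < p then x (fst l) else 1)) +
     (\<Sum>s\<in>{1..fst l}. \<Sum>t\<in>{fst l<..N}. cover_poly N (snd l) u s t * eq_poly N (transpose s t) u u')"

fun walk_poly ::
    "nat \<Rightarrow> (nat \<Rightarrow> 'r) \<Rightarrow> (nat \<Rightarrow> nat) \<Rightarrow> (nat \<times> nat) list \<Rightarrow>
      (nat \<Rightarrow> nat \<Rightarrow> 'r) \<Rightarrow> (nat \<Rightarrow> nat \<Rightarrow> nat \<Rightarrow> 'r) \<Rightarrow> 'r::comm_ring_1" where
  "walk_poly N x \<pi> [] u U = eq_poly N id u (perm_matrix N \<pi>)"
| "walk_poly N x \<pi> (l # L) u U =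
     step_poly N x l u (U 0) * walk_poly N x \<pi> L (U 0) (\<lambda>k. U (Suc k))"

section \<open>Evaluation at permutation matrices\<close>

lemma zero_one_perm_matrix: "zero_one_matrix N (perm_matrix N \<sigma>)"
  by (auto simp: zero_one_matrix_def perm_matrix_def)

text \<open>Inside the square the entry 1 of a row reveals the value; outside, both permutations are
  the identity.\<close>

lemma perm_matrix_eq_iff:
  assumes "\<sigma> permutes {1..N}" "\<sigma>' permutes {1..N}"
  shows "perm_matrix N \<sigma> = (perm_matrix N \<sigma>' :: _ \<Rightarrow> _ \<Rightarrow> 'r::comm_ring_1) \<longleftrightarrow> \<sigma> = \<sigma>'"
proof
  assume eq: "perm_matrix N \<sigma> = (perm_matrix N \<sigma>' :: _ \<Rightarrow> _ \<Rightarrow> 'r)"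
  show "\<sigma> = \<sigma>'"
  proof
    fix p
    show "\<sigma> p = \<sigma>' p"
    proof (cases "p \<in> {1..N}")
      case True
      moreover from this have "\<sigma> p \<in> {1..N}" using assms(1) permutes_in_image by metis
      ultimately show ?thesis
        using fun_cong[OF fun_cong[OF eq], of p "\<sigma> p"] by (simp add: perm_matrix_def)
    next
      case False
      then show ?thesis using assms by (simp add: permutes_not_in)
    qed
  qed
qed simp

lemma prod_of_bool:
  "finite A \<Longrightarrow> (\<Prod>x\<in>A. of_bool (P x)) = (of_bool (\<forall>x\<in>A. P x) :: 'r::comm_semiring_1)"
  by (induction A rule: finite_induct) auto

lemma sum_of_bool_unique:
  assumes "finite A" "\<And>x y. x \<in> A \<Longrightarrow> y \<in> A \<Longrightarrow> P x \<Longrightarrow> P y \<Longrightarrow> x = y"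
  shows "(\<Sum>x\<in>A. of_bool (P x)) = (of_bool (\<exists>x\<in>A. P x) :: 'r::comm_semiring_1)"
proof (cases "\<exists>x\<in>A. P x")
  case True
  then obtain x where x: "x \<in> A" "P x" by blast
  then have "(\<Sum>x\<in>A. of_bool (P x) :: 'r) = (\<Sum>y\<in>A. if y = x then 1 else 0)"
    using assms(2) by (intro sum.cong) auto
  then show ?thesis using x assms(1) by auto
qed auto

lemma eq_poly_perm_matrix:
  assumes "zero_one_matrix N u" "\<tau> permutes {1..N}"
  shows "eq_poly N \<tau> (perm_matrix N \<sigma>) u = of_bool (u = perm_matrix N (\<sigma> \<circ> \<tau>))"
proof -
  have "eq_poly N \<tau> (perm_matrix N \<sigma>) u =
      (\<Prod>p\<in>{1..N}. \<Prod>w\<in>{1..N}. of_bool (u p w = perm_matrix N (\<sigma> \<circ> \<tau>) p w))"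
    unfolding eq_poly_def
  proof (intro prod.cong refl)
    fix p w assume "p \<in> {1..N}" "w \<in> {1..N}"
    moreover from this have "\<tau> p \<in> {1..N}" using assms(2) permutes_in_image by metis
    moreover have "u p w = 0 \<or> u p w = 1" using assms(1) by (auto simp: zero_one_matrix_def)
    ultimately show "perm_matrix N \<sigma> (\<tau> p) w * u p w + (1 - perm_matrix N \<sigma> (\<tau> p) w) * (1 - u p w) =
        of_bool (u p w = perm_matrix N (\<sigma> \<circ> \<tau>) p w)"
      by (auto simp: perm_matrix_def)
  qed
  also have "\<dots> = of_bool (\<forall>p\<in>{1..N}. \<forall>w\<in>{1..N}. u p w = perm_matrix N (\<sigma> \<circ> \<tau>) p w)"
    by (simp add: prod_of_bool)
  also have "(\<forall>p\<in>{1..N}. \<forall>w\<in>{1..N}. u p w = perm_matrix N (\<sigma> \<circ> \<tau>) p w) \<longleftrightarrow>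
      u = perm_matrix N (\<sigma> \<circ> \<tau>)"
  proof (intro iffI ext)
    fix p w assume "\<forall>p\<in>{1..N}. \<forall>w\<in>{1..N}. u p w = perm_matrix N (\<sigma> \<circ> \<tau>) p w"
    then show "u p w = perm_matrix N (\<sigma> \<circ> \<tau>) p w"
      using assms(1) zero_one_perm_matrix[of N "\<sigma> \<circ> \<tau>", where 'a = 'a]
      by (cases "p \<in> {1..N} \<and> w \<in> {1..N}") (auto simp: zero_one_matrix_def)
  qed simp
  finally show ?thesis .
qed

lemma cover_poly_perm_matrix:
  assumes \<sigma>: "\<sigma> permutes {1..N}" and st: "1 \<le> s" "s < t" "t \<le> N" and b: "b \<in> {1..N}"
  shows "cover_poly N b (perm_matrix N \<sigma>) s t =
    of_bool (b = \<sigma> s \<and> cover_at N s t \<sigma> (\<sigma> \<circ> transpose s t))"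
proof -
  let ?P = "\<lambda>a. \<forall>p\<in>{s<..<t}. \<sigma> p \<notin> {b<..<a}"
  have in_range: "\<sigma> t \<in> {1..N}" using st by (subst permutes_in_image[OF \<sigma>]) auto
  have "perm_matrix N \<sigma> t a * (\<Prod>p\<in>{s<..<t}. \<Prod>w\<in>{b<..<a}. 1 - perm_matrix N \<sigma> p w :: 'a) =
      of_bool (\<sigma> t = a \<and> ?P a)" if "a \<in> {b<..N}" for a
  proof -
    have "(\<Prod>p\<in>{s<..<t}. \<Prod>w\<in>{b<..<a}. 1 - perm_matrix N \<sigma> p w :: 'a) =
        (\<Prod>p\<in>{s<..<t}. \<Prod>w\<in>{b<..<a}. of_bool (\<sigma> p \<noteq> w))"
      using st that b by (intro prod.cong refl) (auto simp: perm_matrix_def)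
    also have "\<dots> = of_bool (\<forall>p\<in>{s<..<t}. \<forall>w\<in>{b<..<a}. \<sigma> p \<noteq> w)"
      by (simp only: prod_of_bool finite_greaterThanLessThan)
    also have "(\<forall>p\<in>{s<..<t}. \<forall>w\<in>{b<..<a}. \<sigma> p \<noteq> w) \<longleftrightarrow> ?P a"
      by blast
    finally show ?thesis
      using st that b by (simp add: perm_matrix_def of_bool_conj[symmetric])
  qed
  then have "(\<Sum>a\<in>{b<..N}. perm_matrix N \<sigma> t a *
        (\<Prod>p\<in>{s<..<t}. \<Prod>w\<in>{b<..<a}. 1 - perm_matrix N \<sigma> p w) :: 'a) =
      of_bool (\<exists>a\<in>{b<..N}. \<sigma> t = a \<and> ?P a)"
    by (subst sum_of_bool_unique[symmetric]) auto
  also have "(\<exists>a\<in>{b<..N}. \<sigma> t = a \<and> ?P a) \<longleftrightarrow>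
      b < \<sigma> t \<and> (\<forall>p. s < p \<and> p < t \<longrightarrow> \<not> (b < \<sigma> p \<and> \<sigma> p < \<sigma> t))"
  proof -
    have "?P (\<sigma> t) \<longleftrightarrow> (\<forall>p. s < p \<and> p < t \<longrightarrow> \<not> (b < \<sigma> p \<and> \<sigma> p < \<sigma> t))"
      by (auto simp: Ball_def)
    then show ?thesis using in_range by auto
  qed
  finally show ?thesis
    unfolding cover_poly_def cover_at_iff[OF \<sigma> st] using st b by (auto simp: perm_matrix_def)
qed

lemma step_poly_perm_matrix:
  assumes \<sigma>: "\<sigma> permutes {1..N}" and \<sigma>': "\<sigma>' permutes {1..N}" and l: "l \<in> set (label_grid N)"
  shows "step_poly N x l (perm_matrix N \<sigma>) (perm_matrix N \<sigma>') = step_weight N x l \<sigma> \<sigma>'"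
proof -
  obtain i b where ib: "l = (i, b)" "i \<in> {1..<N}" "b \<in> {1..N}"
    using l unfolding set_label_grid by blast
  obtain q where q: "q \<in> {1..N}" "\<sigma> q = b"
    using permutes_image[OF \<sigma>] ib(3) by (metis imageE)
  have \<sigma>_eq: "\<sigma> p = b \<longleftrightarrow> p = q" for p
    using q permutes_inj[OF \<sigma>] by (auto simp: inj_eq)
  have "(\<Sum>p\<in>{1..N}. perm_matrix N \<sigma> p b * (if i < p then x i else 1)) =
      (\<Sum>p\<in>{1..N}. if p = q then (if i < q then x i else 1) else 0)"
    using ib by (intro sum.cong refl) (auto simp: perm_matrix_def \<sigma>_eq)
  also have "\<dots> = x i ^ stay_exp N l \<sigma>"
    using q ib by (auto simp: stay_exp_def \<sigma>_eq)
  finally have stay: "(\<Sum>p\<in>{1..N}. perm_matrix N \<sigma> p b * (if i < p then x i else 1)) =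
      x i ^ stay_exp N l \<sigma>" .
  have eq: "eq_poly N \<tau> (perm_matrix N \<sigma>) (perm_matrix N \<sigma>') = of_bool (\<sigma>' = \<sigma> \<circ> \<tau>)"
    if "\<tau> permutes {1..N}" for \<tau>
    using that permutes_compose[OF that \<sigma>] \<sigma>'
    by (simp add: eq_poly_perm_matrix zero_one_perm_matrix perm_matrix_eq_iff)
  let ?Q = "\<lambda>st. b = \<sigma> (fst st) \<and> cover_at N (fst st) (snd st) \<sigma> \<sigma>'"
  let ?sum = "\<Sum>s\<in>{1..i}. \<Sum>t\<in>{i<..N}. cover_poly N b (perm_matrix N \<sigma>) s t *
        eq_poly N (transpose s t) (perm_matrix N \<sigma>) (perm_matrix N \<sigma>')"
  have "?sum = (\<Sum>s\<in>{1..i}. \<Sum>t\<in>{i<..N}. of_bool (?Q (s, t)))"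
  proof (intro sum.cong refl)
    fix s t assume "s \<in> {1..i}" "t \<in> {i<..N}"
    then show "cover_poly N b (perm_matrix N \<sigma>) s t *
        eq_poly N (transpose s t) (perm_matrix N \<sigma>) (perm_matrix N \<sigma>') = of_bool (?Q (s, t))"
      using ib \<sigma> permutes_swap_id[of s "{1..N}" t]
      by (subst cover_poly_perm_matrix, simp_all add: eq) (auto simp: cover_at_def)
  qed
  also have "\<dots> = (\<Sum>st\<in>{1..i} \<times> {i<..N}. of_bool (?Q st))"
    by (simp only: sum.cartesian_product case_prod_unfold prod.collapse)
  also have "\<dots> = of_bool (\<exists>st\<in>{1..i} \<times> {i<..N}. ?Q st)"
  proof (rule sum_of_bool_unique)
    fix st st' assume Q: "?Q st" "?Q st'"
    \<comment> \<open>The edge determines the pair: \<open>s\<close> is the position of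
      \<open>b\<close> in \<open>\<sigma>\<close> and \<open>t\<close> its position in
      \<open>\<sigma>'\<close>. So each edge is counted once.\<close>
    have unique: "fst st = q \<and> \<sigma>' (snd st) = b" if "?Q st" for st
      using that \<sigma>_eq[of "fst st"] by (simp add: cover_at_def)
    have "snd st = snd st'"
      by (rule injD[OF permutes_inj[OF \<sigma>']]) (simp add: unique[OF Q(1)] unique[OF Q(2)])
    then show "st = st'"
      by (intro prod_eqI) (simp_all add: unique[OF Q(1)] unique[OF Q(2)])
  qed auto
  also have "(\<exists>st\<in>{1..i} \<times> {i<..N}. ?Q st) \<longleftrightarrow> (\<sigma>, l, \<sigma>') \<in> labeled_edges N"
  proof
    assume "(\<sigma>, l, \<sigma>') \<in> labeled_edges N"
    then obtain s t where "cover_at N s t \<sigma> \<sigma>'" "s \<le> i" "i < t" "b = \<sigma> s"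
      unfolding ib(1) by (rule labeled_edge_cases)
    then show "\<exists>st\<in>{1..i} \<times> {i<..N}. ?Q st"
      by (intro bexI[of _ "(s, t)"]) (auto simp: cover_at_def)
  next
    assume "\<exists>st\<in>{1..i} \<times> {i<..N}. ?Q st"
    then obtain s t where "s \<in> {1..i}" "t \<in> {i<..N}" "b = \<sigma> s" "cover_at N s t \<sigma> \<sigma>'"
      by auto
    then show "(\<sigma>, l, \<sigma>') \<in> labeled_edges N"
      unfolding labeled_edges_def ib(1) by auto
  qed
  finally have move: "?sum = of_bool ((\<sigma>, l, \<sigma>') \<in> labeled_edges N)" .
  have "step_poly N x l (perm_matrix N \<sigma>) (perm_matrix N \<sigma>') =
      of_bool (\<sigma>' = \<sigma> \<circ> id) * x i ^ stay_exp N l \<sigma> + ?sum"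
    unfolding step_poly_def eq[OF permutes_id] stay[symmetric] by (simp only: ib(1) fst_conv snd_conv)
  then show ?thesis
    unfolding step_weight_def move by (simp add: ib(1))
qed

text \<open>Every summand of the step polynomial contains an equality test of \<open>u\<close>, so a
  nonzero value forces \<open>u\<close> to be the matrix of \<open>\<sigma>\<close> or of
  \<open>\<sigma>\<close> with two positions exchanged. This disposes of the 0-1 matrices that are
  no permutation matrices.\<close>

lemma step_poly_nonzero:
  assumes \<sigma>: "\<sigma> permutes {1..N}" and u: "zero_one_matrix N u"
    and l: "l \<in> set (label_grid N)" and nz: "step_poly N x l (perm_matrix N \<sigma>) u \<noteq> 0"
  shows "\<exists>\<sigma>'. \<sigma>' permutes {1..N} \<and> u = perm_matrix N \<sigma>'"
proof -
  have ex: ?thesis if "eq_poly N \<tau> (perm_matrix N \<sigma>) u \<noteq> 0" "\<tau> permutes {1..N}" for \<tau>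
    using that eq_poly_perm_matrix[OF u that(2), of \<sigma>] permutes_compose[OF that(2) \<sigma>] by auto
  consider "eq_poly N id (perm_matrix N \<sigma>) u \<noteq> 0"
    | s t where "s \<in> {1..fst l}" "t \<in> {fst l<..N}"
        "eq_poly N (transpose s t) (perm_matrix N \<sigma>) u \<noteq> 0"
    using nz unfolding step_poly_def
    by (metis (no_types, lifting) add_0 mult_zero_left mult_zero_right sum.neutral)
  then show ?thesis
  proof cases
    case 1
    then show ?thesis using ex permutes_id by blast
  next
    case 2
    then show ?thesis using ex permutes_swap_id[of s "{1..N}" t] by auto
  qed
qed

lemma walk_poly_perm_matrix:
  assumes "\<sigma> permutes {1..N}" "\<pi> permutes {1..N}" "set L \<subseteq> set (label_grid N)"
    "set \<rho> \<subseteq> {\<sigma>. \<sigma> permutes {1..N}}" "length \<rho> = length L"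
    "\<And>k. k < length L \<Longrightarrow> U k = perm_matrix N (\<rho> ! k)"
  shows "walk_poly N x \<pi> L (perm_matrix N \<sigma>) U = walk_weight N x \<pi> L \<sigma> \<rho>"
  using assms
proof (induction L arbitrary: \<sigma> \<rho> U)
  case Nil
  then show ?case
    by (auto simp: eq_poly_perm_matrix zero_one_perm_matrix perm_matrix_eq_iff permutes_id)
next
  case (Cons l L)
  then obtain \<sigma>' \<rho>' where \<rho>: "\<rho> = \<sigma>' # \<rho>'" by (cases \<rho>) auto
  have "U 0 = perm_matrix N \<sigma>'" using Cons.prems(6)[of 0] by (simp add: \<rho>)
  moreover have "U (Suc k) = perm_matrix N (\<rho>' ! k)" if "k < length L" for k
    using Cons.prems(6)[of "Suc k"] that by (simp add: \<rho>)
  ultimately show ?case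
    using Cons.prems Cons.IH[of \<sigma>' \<rho>' "\<lambda>k. U (Suc k)"]
    by (simp add: \<rho> step_poly_perm_matrix)
qed

text \<open>A nonzero product has nonzero steps, so being a permutation matrix propagates from each
  time to the next.\<close>

lemma walk_poly_nonzero:
  assumes "\<sigma> permutes {1..N}" "set L \<subseteq> set (label_grid N)"
    "\<And>k. zero_one_matrix N (U k)" "walk_poly N x \<pi> L (perm_matrix N \<sigma>) U \<noteq> 0"
  shows "\<exists>\<rho>. set \<rho> \<subseteq> {\<sigma>. \<sigma> permutes {1..N}} \<and> length \<rho> = length L \<and>
    (\<forall>k < length L. U k = perm_matrix N (\<rho> ! k))"
  using assms
proof (induction L arbitrary: \<sigma> U)
  case (Cons l L)
  have "step_poly N x l (perm_matrix N \<sigma>) (U 0) \<noteq> 0" and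
    nz: "walk_poly N x \<pi> L (U 0) (\<lambda>k. U (Suc k)) \<noteq> 0"
    using Cons.prems(4) by auto
  then obtain \<sigma>' where \<sigma>': "\<sigma>' permutes {1..N}" "U 0 = perm_matrix N \<sigma>'"
    using step_poly_nonzero[of \<sigma> N "U 0" l x] Cons.prems by auto
  then obtain \<rho> where "set \<rho> \<subseteq> {\<sigma>. \<sigma> permutes {1..N}}" "length \<rho> = length L"
    "\<forall>k < length L. U (Suc k) = perm_matrix N (\<rho> ! k)"
    using Cons.IH[of \<sigma>' "\<lambda>k. U (Suc k)"] Cons.prems nz by auto
  then show ?case
    using \<sigma>' by (intro exI[of _ "\<sigma>' # \<rho>"]) (auto simp: nth_Cons split: nat.splits)
qed simp


section \<open>The Boolean sum\<close>

lemma CC_eq_iff: "CC a = CC b \<longleftrightarrow> a = b"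
  by (metis CC_def lookup_single_eq)

lemma msubst_perm_matrix: "msubst s (perm_matrix N \<sigma> p w) = perm_matrix N \<sigma> p w"
  by (simp add: perm_matrix_def)

lemma msubst_eq_poly:
  "msubst s (eq_poly N \<tau> u u') = eq_poly N \<tau> (\<lambda>p w. msubst s (u p w)) (\<lambda>p w. msubst s (u' p w))"
  by (simp add: eq_poly_def msubst_prod msubst_add msubst_mult msubst_diff)

lemma msubst_cover_poly:
  "msubst s (cover_poly N b u p q) = cover_poly N b (\<lambda>p w. msubst s (u p w)) p q"
  by (simp add: cover_poly_def msubst_prod msubst_sum msubst_mult msubst_diff)

lemma msubst_step_poly:
  assumes "msubst s (x (fst l)) = x (fst l)"
  shows "msubst s (step_poly N x l u u') =
    step_poly N x l (\<lambda>p w. msubst s (u p w)) (\<lambda>p w. msubst s (u' p w))"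
proof -
  have "msubst s (if P then x (fst l) else 1) = (if P then x (fst l) else 1)" for P
    using assms by simp
  then show ?thesis
    by (simp add: step_poly_def msubst_add msubst_sum msubst_mult msubst_eq_poly msubst_cover_poly)
qed

text \<open>The substitutions of interest fix the variables in the weights, so only the matrix
  entries change.\<close>

lemma msubst_walk_poly:
  assumes "\<And>l. l \<in> set L \<Longrightarrow> msubst s (x (fst l)) = x (fst l)"
  shows "msubst s (walk_poly N x \<pi> L u U) =
    walk_poly N x \<pi> L (\<lambda>p w. msubst s (u p w)) (\<lambda>k p w. msubst s (U k p w))"
  using assms
  by (induction L arbitrary: u U)
     (simp_all add: msubst_mult msubst_step_poly msubst_eq_poly msubst_perm_matrix)

definition matrix_entries :: "nat \<Rightarrow> (nat \<times> nat \<times> nat) set" where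
  "matrix_entries N = {..<length (label_grid N)} \<times> {1..N} \<times> {1..N}"

text \<open>The bijection \<open>\<beta>\<close> numbers the Boolean variables, which are placed
  after the \<open>N - 1\<close> variables of the skew Schubert polynomial. Elsewhere 0 is plugged
  in, as \<open>zero_one_matrix\<close> demands.\<close>

definition walk_family ::
    "(nat \<times> nat \<times> nat \<Rightarrow> nat) \<Rightarrow> nat \<Rightarrow> (nat \<Rightarrow> nat) \<Rightarrow> (nat \<Rightarrow> nat) \<Rightarrow> 'a::comm_ring_1 mpoly" where
  "walk_family \<beta> N \<pi> \<sigma> = walk_poly N XX \<pi> (label_grid N) (perm_matrix N \<sigma>)
     (\<lambda>k p w. if (k, p, w) \<in> matrix_entries N then XX (N - 1 + \<beta> (k, p, w)) else 0)"

text \<open>Assignments \<open>c\<close> are sequences of 0-1 matrices. Those encoding sequences of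
  permutations give walk weights, all others give 0, and the encoding is injective, so the Boolean
  sum is the sum over walks.\<close>

lemma boolean_sum_walk_family:
  fixes \<sigma> \<pi> :: "nat \<Rightarrow> nat"
  assumes \<beta>: "bij_betw \<beta> (matrix_entries N) {1..m}"
    and \<sigma>: "\<sigma> permutes {1..N}" and \<pi>: "\<pi> permutes {1..N}"
  shows "boolean_sum (N - 1) m (walk_family \<beta> N \<pi> \<sigma>) = (skew_schubert N \<pi> \<sigma> :: 'a::field mpoly)"
proof -
  let ?L = "label_grid N"
  let ?D = "matrix_entries N"
  let ?R = "{\<rho>. set \<rho> \<subseteq> {\<sigma>. \<sigma> permutes {1..N}} \<and> length \<rho> = length ?L}"
  let ?A = "{1..m} \<rightarrow>\<^sub>E {0, 1 :: 'a}"
  define V :: "(nat \<Rightarrow> 'a) \<Rightarrow> nat \<Rightarrow> nat \<Rightarrow> nat \<Rightarrow> 'a mpoly" where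
    "V c k p w = (if (k, p, w) \<in> ?D then CC (c (\<beta> (k, p, w))) else 0)" for c k p w
  define F where "F c = walk_poly N XX \<pi> ?L (perm_matrix N \<sigma>) (V c)" for c
  \<comment> \<open>Variable \<open>i\<close> receives the matrix entry that \<open>\<beta>\<close>
    numbers by \<open>i\<close>. The restriction to \<open>{1..m}\<close> makes the assignment
    extensional, as membership in \<open>?A\<close> requires.\<close>
  define enc :: "(nat \<Rightarrow> nat) list \<Rightarrow> nat \<Rightarrow> 'a" where
    "enc \<rho> = (\<lambda>i\<in>{1..m}. case inv_into ?D \<beta> i of (k, p, w) \<Rightarrow> of_bool ((\<rho> ! k) p = w))" for \<rho>
  have \<beta>_in: "\<beta> d \<in> {1..m}" and inv_\<beta>: "inv_into ?D \<beta> (\<beta> d) = d" if "d \<in> ?D" for d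
    using that \<beta> by (auto simp: bij_betw_def)
  have V_enc: "V (enc \<rho>) k = perm_matrix N (\<rho> ! k)" if "k < length ?L" for \<rho> k
  proof (intro ext)
    fix p w
    show "V (enc \<rho>) k p w = perm_matrix N (\<rho> ! k) p w"
    proof (cases "(k, p, w) \<in> ?D")
      case True
      then show ?thesis
        using \<beta>_in[OF True] inv_\<beta>[OF True] by (auto simp: V_def enc_def perm_matrix_def matrix_entries_def)
    next
      case False
      then show ?thesis
        using that by (auto simp: V_def perm_matrix_def matrix_entries_def)
    qed
  qed
  have F_enc: "F (enc \<rho>) = walk_weight N XX \<pi> ?L \<sigma> \<rho>" if "\<rho> \<in> ?R" for \<rho>
    unfolding F_def using that \<sigma> \<pi> V_enc by (intro walk_poly_perm_matrix) auto
  have enc_in: "enc \<rho> \<in> ?A" for \<rho>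
    by (auto simp: enc_def split: prod.splits)
  have enc_if_nonzero: "c \<in> enc ` ?R" if c: "c \<in> ?A" and nz: "F c \<noteq> 0" for c
  proof -
    have "V c k p w \<in> {0, 1}" for k p w
      using PiE_mem[OF c \<beta>_in[of "(k, p, w)"]] by (auto simp: V_def)
    moreover have "V c k p w = 0" if "p \<notin> {1..N} \<or> w \<notin> {1..N}" for k p w
      using that by (auto simp: V_def matrix_entries_def)
    ultimately have "zero_one_matrix N (V c k)" for k
      unfolding zero_one_matrix_def by blast
    then obtain \<rho> where \<rho>: "\<rho> \<in> ?R" "\<forall>k < length ?L. V c k = perm_matrix N (\<rho> ! k)"
      using walk_poly_nonzero[OF \<sigma> order_refl _ nz[unfolded F_def]] by blast
    have "c i = enc \<rho> i" if i: "i \<in> {1..m}" for i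
    proof -
      have "i \<in> \<beta> ` ?D" using i \<beta> by (simp add: bij_betw_def)
      then obtain k p w where d: "(k, p, w) \<in> ?D" "i = \<beta> (k, p, w)" by auto
      then have k: "k < length ?L" by (simp add: matrix_entries_def)
      have "V c k p w = V (enc \<rho>) k p w" using \<rho>(2) V_enc k by simp
      then show ?thesis using d by (simp add: V_def CC_eq_iff)
    qed
    then have "c = enc \<rho>"
      by (intro PiE_ext[OF c enc_in])
    then show ?thesis using \<rho>(1) by blast
  qed
  have inj: "inj_on enc ?R"
  proof (rule inj_onI)
    fix \<rho> \<rho>' assume R: "\<rho> \<in> ?R" "\<rho>' \<in> ?R" and eq: "enc \<rho> = enc \<rho>'"
    show "\<rho> = \<rho>'"
    proof (rule nth_equalityI)
      fix k assume "k < length \<rho>"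
      then have k: "k < length ?L" "k < length \<rho>" "k < length \<rho>'" using R by auto
      then have "\<rho> ! k permutes {1..N}" "\<rho>' ! k permutes {1..N}"
        using R(1) nth_mem[OF k(2)] R(2) nth_mem[OF k(3)] by blast+
      moreover have "perm_matrix N (\<rho> ! k) = (perm_matrix N (\<rho>' ! k) :: _ \<Rightarrow> _ \<Rightarrow> 'a mpoly)"
        using V_enc[OF k(1), of \<rho>] V_enc[OF k(1), of \<rho>'] eq by simp
      ultimately show "\<rho> ! k = \<rho>' ! k" by (simp add: perm_matrix_eq_iff)
    qed (use R in simp)
  qed
  \<comment> \<open>The values of \<open>\<beta>\<close> start at 1, so the entry variables have
    indices above \<open>N - 1\<close> and become constants, whereas the weights only use
    \<open>XX i\<close> with \<open>i \<le> N - 1\<close>.\<close>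
  have "msubst (\<lambda>i. if i \<le> N - 1 then XX i else CC (c (i - (N - 1)))) (walk_family \<beta> N \<pi> \<sigma>) = F c" for c
  proof -
    let ?s = "\<lambda>i. if i \<le> N - 1 then XX i else CC (c (i - (N - 1)))"
    have "msubst ?s (walk_family \<beta> N \<pi> \<sigma>) = walk_poly N XX \<pi> ?L (perm_matrix N \<sigma>)
        (\<lambda>k p w. msubst ?s (if (k, p, w) \<in> ?D then XX (N - 1 + \<beta> (k, p, w)) else 0))"
      unfolding walk_family_def
      by (subst msubst_walk_poly) (auto simp: msubst_perm_matrix set_label_grid)
    moreover have "msubst ?s (if (k, p, w) \<in> ?D then XX (N - 1 + \<beta> (k, p, w)) else 0) = V c k p w"
      for k p w
      using \<beta>_in[of "(k, p, w)"] by (auto simp: V_def)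
    ultimately show ?thesis by (simp add: F_def)
  qed
  then have "boolean_sum (N - 1) m (walk_family \<beta> N \<pi> \<sigma>) = (\<Sum>c\<in>?A. F c)"
    by (simp only: boolean_sum_def)
  also have "\<dots> = (\<Sum>c\<in>enc ` ?R. F c)"
    by (rule sum.mono_neutral_right) (use enc_in enc_if_nonzero in \<open>auto intro!: finite_PiE\<close>)
  also have "\<dots> = (\<Sum>\<rho>\<in>?R. walk_weight N XX \<pi> ?L \<sigma> \<rho>)"
    by (subst sum.reindex[OF inj], rule sum.cong) (auto simp: F_enc)
  also have "\<dots> = skew_schubert N \<pi> \<sigma>"
    by (rule skew_schubert_eq_walk_sum[OF \<sigma>, symmetric])
  finally show ?thesis .
qed


section \<open>Size of the formulas\<close>

lemma has_formula_one_minus: "has_formula v 1 p \<Longrightarrow> has_formula v 5 (1 - p)"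
  using has_formula_diff[OF has_formula_01(2), of v 1 p] by simp

lemma has_formula_perm_matrix: "has_formula v 1 (perm_matrix N \<sigma> p w)"
  by (simp add: perm_matrix_def has_formula_01[simplified])

text \<open>The size bounds are left in the shape in which the closure rules build them, so that
  these rules unify directly. The 15 is for one factor: products of sizes 3 and 11 and the gate
  adding them.\<close>

definition eq_size :: "nat \<Rightarrow> nat" where
  "eq_size N = N * ((N * (15 + 1) + 1) + 1) + 1"

lemma has_formula_eq_poly:
  assumes "\<And>p w. has_formula v 1 (u p w)" "\<And>p w. has_formula v 1 (u' p w)"
  shows "has_formula v (eq_size N) (eq_poly N \<tau> u u')"
proof -
  have "has_formula v 15 (u (\<tau> p) w * u' p w + (1 - u (\<tau> p) w) * (1 - u' p w))" for p w
    using has_formula_add[OF has_formula_mult[OF assms]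
        has_formula_mult[OF has_formula_one_minus[OF assms(1)] has_formula_one_minus[OF assms(2)]],
        of "\<tau> p" w p w "\<tau> p" w p w] by simp
  then show ?thesis
    unfolding eq_poly_def eq_size_def by (intro has_formula_prod) auto
qed

text \<open>All index ranges have at most \<open>N\<close> elements, and 5 is the size of
  \<open>1 - u p w\<close>.\<close>

definition cover_size :: "nat \<Rightarrow> nat" where
  "cover_size N = 1 + (N * ((1 + (N * ((N * (5 + 1) + 1) + 1) + 1) + 1) + 1) + 1) + 1"

lemma has_formula_cover_poly:
  assumes "\<And>p w. has_formula v 1 (u p w)" "t \<le> N"
  shows "has_formula v (cover_size N) (cover_poly N b u s t)"
  unfolding cover_poly_def cover_size_def
  by (intro has_formula_mult has_formula_sum has_formula_prod has_formula_one_minus)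
     (use assms in auto)

definition step_size :: "nat \<Rightarrow> nat" where
  "step_size N = (eq_size N + (N * ((1 + 1 + 1) + 1) + 1) + 1) +
     (N * ((N * ((cover_size N + eq_size N + 1) + 1) + 1) + 1) + 1) + 1"

lemma has_formula_step_poly:
  assumes "\<And>p w. has_formula v 1 (u p w)" "\<And>p w. has_formula v 1 (u' p w)"
    "has_formula v 1 (x (fst l))" "fst l \<le> N"
  shows "has_formula v (step_size N) (step_poly N x l u u')"
  unfolding step_poly_def step_size_def
  by (intro has_formula_add has_formula_mult has_formula_sum has_formula_eq_poly
      has_formula_cover_poly) (use assms has_formula_01[of v] in auto)

lemma has_formula_walk_poly:
  assumes "\<And>p w. has_formula v 1 (u p w)" "\<And>k p w. has_formula v 1 (U k p w)"
    "\<And>l. l \<in> set L \<Longrightarrow> has_formula v 1 (x (fst l)) \<and> fst l \<le> N"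
  shows "has_formula v (length L * (step_size N + 1) + eq_size N) (walk_poly N x \<pi> L u U)"
  using assms
proof (induction L arbitrary: u U)
  case Nil
  have "has_formula v (eq_size N) (eq_poly N id u (perm_matrix N \<pi>))"
    using Nil.prems(1) has_formula_perm_matrix by (rule has_formula_eq_poly)
  then show ?case by simp
next
  case (Cons l L)
  have "has_formula v (step_size N + (length L * (step_size N + 1) + eq_size N) + 1)
      (step_poly N x l u (U 0) * walk_poly N x \<pi> L (U 0) (\<lambda>k. U (Suc k)))"
    using Cons by (intro has_formula_mult has_formula_step_poly) auto
  then show ?case by (simp add: algebra_simps)
qed

lemma has_formula_walk_family:
  assumes \<beta>: "bij_betw \<beta> (matrix_entries N) {1..m}"
  shows "has_formula (N - 1 + m) (N * N * (step_size N + 1) + eq_size N) (walk_family \<beta> N \<pi> \<sigma> :: 'a::comm_ring_1 mpoly)"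
proof -
  have \<beta>_in: "\<beta> d \<in> {1..m}" if "d \<in> matrix_entries N" for d
    using that \<beta> by (auto simp: bij_betw_def)
  have entry: "has_formula (N - 1 + m) 1
      (if (k, p, w) \<in> matrix_entries N then XX (N - 1 + \<beta> (k, p, w)) else 0 :: 'a mpoly)" for k p w
    using \<beta>_in[of "(k, p, w)"] has_formula_XX[of "N - 1 + \<beta> (k, p, w)" "N - 1 + m", where 'a = 'a]
      has_formula_01(1)[of "N - 1 + m", where 'a = 'a] by auto
  have var: "has_formula (N - 1 + m) 1 (XX (fst l) :: 'a mpoly) \<and> fst l \<le> N"
    if "l \<in> set (label_grid N)" for l
    using that by (auto simp: set_label_grid intro!: has_formula_XX[simplified])
  have "has_formula (N - 1 + m) (length (label_grid N) * (step_size N + 1) + eq_size N)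
      (walk_family \<beta> N \<pi> \<sigma> :: 'a mpoly)"
    unfolding walk_family_def by (rule has_formula_walk_poly[OF has_formula_perm_matrix entry var])
  then show ?thesis
    by (rule has_formula_mono)
       (unfold length_label_grid, intro add_mono mult_le_mono order_refl, simp)
qed

section \<open>Membership in VNP\<close>

lemma mvars_skew_schubert: "mvars (skew_schubert N \<pi> \<sigma> :: 'a::comm_ring_1 mpoly) \<subseteq> {1..N - 1}"
proof -
  have "mvars (XX i ^ k :: 'a mpoly) \<subseteq> {1..N - 1}" if "i \<in> {1..<N}" for i k
    using mvars_power[of "XX i :: 'a mpoly" k] mvars_XX[of i, where 'a = 'a] that by auto
  then have "mvars (\<Prod>i\<in>{1..<N}. XX i ^ ((N - i) - label_count C i) :: 'a mpoly) \<subseteq> {1..N - 1}" for C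
    using mvars_prod[of "\<lambda>i. XX i ^ ((N - i) - label_count C i) :: 'a mpoly" "{1..<N}"] by blast
  then show ?thesis
    unfolding skew_schubert_def
    using mvars_sum[of "\<lambda>C. \<Prod>i\<in>{1..<N}. XX i ^ ((N - i) - label_count C i) :: 'a mpoly"
        "increasing_chains N \<sigma> \<pi>"] by blast
qed

lemma skew_schubert_in_VNP:
  assumes "\<And>N. \<sigma> N permutes {1..N}" "\<And>N. \<pi> N permutes {1..N}"
  shows "in_VNP (\<lambda>N. N - 1) (\<lambda>N. skew_schubert N (\<pi> N) (\<sigma> N) :: 'a::field mpoly)"
proof -
  define m where "m = (\<lambda>N. card (matrix_entries N))"
  have "\<exists>\<beta>. bij_betw \<beta> (matrix_entries N) {1..m N}" for N
    by (rule finite_same_card_bij) (auto simp: matrix_entries_def m_def)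
  then obtain \<beta> where \<beta>: "\<And>N. bij_betw (\<beta> N) (matrix_entries N) {1..m N}"
    by metis
  \<comment> \<open>There are \<open>(N - 1) * N\<close> times and \<open>N * N\<close> entries for
    each of them.\<close>
  have m: "poly_bounded m"
    by (rule poly_bounded_mono[of "\<lambda>N. N * N * N * N"])
       (auto simp: m_def matrix_entries_def card_cartesian_product length_label_grid poly_bounded_intros)
  have "poly_bounded (\<lambda>N. N - 1)"
    by (rule poly_bounded_mono[OF poly_bounded_id]) simp
  with m have "poly_bounded (\<lambda>N. N - 1 + m N)"
    by (intro poly_bounded_add)
  moreover have "poly_bounded (\<lambda>N. N * N * (step_size N + 1) + eq_size N)"
    unfolding step_size_def eq_size_def cover_size_def by (intro poly_bounded_intros)
  ultimately have "in_VP (\<lambda>N. N - 1 + m N) (\<lambda>N. walk_family (\<beta> N) N (\<pi> N) (\<sigma> N) :: 'a mpoly)"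
    by (rule in_VP_if_has_formula) (rule has_formula_walk_family[OF \<beta>])
  then show ?thesis
    using m mvars_skew_schubert boolean_sum_walk_family[OF \<beta> assms, symmetric]
    unfolding in_VNP_def by blast
qed

lemma max_perm_permutes: "max_perm N permutes {1..N}"
proof (rule bij_imp_permutes)
  \<comment> \<open>The order reversal is its own inverse.\<close>
  show "bij_betw (max_perm N) {1..N} {1..N}"
    by (rule bij_betw_byWitness[of _ "max_perm N"]) (auto simp: max_perm_def)
qed (auto simp: max_perm_def)

theorem theorem1p4:
  shows "(\<forall>\<sigma> \<pi>.
            (\<forall>N. \<sigma> N permutes {1..N} \<and> \<pi> N permutes {1..N} \<and> bruhat_le N (\<sigma> N) (\<pi> N)) \<longrightarrow>
            in_VNP (\<lambda>N. N - 1) (\<lambda>N. skew_schubert N (\<pi> N) (\<sigma> N) :: 'a::field mpoly)) \<and>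
         (\<forall>\<sigma>.
            (\<forall>N. \<sigma> N permutes {1..N}) \<longrightarrow>
            in_VNP (\<lambda>N. N - 1) (\<lambda>N. schubert N (\<sigma> N) :: 'a::field mpoly))"
  unfolding schubert_def by (intro conjI allI impI skew_schubert_in_VNP max_perm_permutes) auto

end
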